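(* Let $R$ be a graded ring, let $\Theta$ be a graded left $R$-module, and let $M$ be a graded left $R$-module. Then the following are equivalent: (1) $M$ is $\Theta$-rational. (2) For every homogeneous $m\in M$, the left annihilator $\mathrm{ann}_\ell(m)=\{r\in R: rm=0\}$ is a $\Theta$-distinguished left ideal of $R$. (3) $M$ is $\Theta$-distinguished-torsion.
   Context: Gradings are $\mathbb{Z}$-gradings and modules are left modules. A graded left $R$-module $M$ is called $\Theta$-rational if $M$ is (isomorphic to) a graded submodule of a graded quotient module of a coproduct of copies of suspensions of $\Theta$. A homogeneous left ideal of $R$ is strongly $\Theta$-distinguished if it is equal to $\mathrm{ann}_\ell(\theta)=\{r\in R: r\theta=0\}$ for some nonzero homogeneous $\theta\in\Theta$. A homogeneous left ideal of $R$ is $\Theta$-distinguished if it contains the intersection of a finite set of strongly $\Theta$-distinguished left ideals (the empty intersection being $R$). Let $\overline{\mathrm{dist}\,\Theta}$ be the set of all intersections of finite sets of strongly $\Theta$-distinguished left ideals. For a graded left $R$-module $M$, let $h^0_{\overline{\mathrm{dist}\,\Theta}}(M)$ be the graded subgroup of $M$ generated by all homogeneous elements $m$ such that $Im=0$ for some $I\in\overline{\mathrm{dist}\,\Theta}$, and let $H^0_{\overline{\mathrm{dist}\,\Theta}}(M)$ be the graded $R$-submodule of $M$ generated by $h^0_{\overline{\mathrm{dist}\,\Theta}}(M)$. The module $M$ is $\Theta$-distinguished-torsion if the inclusion $H^0_{\overline{\mathrm{dist}\,\Theta}}(M)\hookrightarrow M$ is an isomorphism. *)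

theory Defs
  imports "HOL-Algebra.Algebra"
begin

text \<open>
  The locale \<^locale>\<open>module\<close> of HOL-Algebra requires a commutative ring. The following is the same
  for left modules over an arbitrary unital ring; it shares the record type of modules, and
  the locale \<^locale>\<open>submodule\<close> can be used unchanged. The multiplicative fields of the
  module record play no role.
\<close>

locale left_module = R?: ring R + M?: abelian_group M
  for R :: "('a, 'c) ring_scheme" (structure) and M :: "('a, 'm, 'd) module_scheme" (structure) +
  assumes smult_closed [simp, intro]:
      "\<lbrakk>a \<in> carrier R; x \<in> carrier M\<rbrakk> \<Longrightarrow> a \<odot>\<^bsub>M\<^esub> x \<in> carrier M"
    and smult_l_distr:
      "\<lbrakk>a \<in> carrier R; b \<in> carrier R; x \<in> carrier M\<rbrakk> \<Longrightarrow>
       (a \<oplus> b) \<odot>\<^bsub>M\<^esub> x = a \<odot>\<^bsub>M\<^esub> x \<oplus>\<^bsub>M\<^esub> b \<odot>\<^bsub>M\<^esub> x"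
    and smult_r_distr:
      "\<lbrakk>a \<in> carrier R; x \<in> carrier M; y \<in> carrier M\<rbrakk> \<Longrightarrow>
       a \<odot>\<^bsub>M\<^esub> (x \<oplus>\<^bsub>M\<^esub> y) = a \<odot>\<^bsub>M\<^esub> x \<oplus>\<^bsub>M\<^esub> a \<odot>\<^bsub>M\<^esub> y"
    and smult_assoc:
      "\<lbrakk>a \<in> carrier R; b \<in> carrier R; x \<in> carrier M\<rbrakk> \<Longrightarrow>
       (a \<otimes> b) \<odot>\<^bsub>M\<^esub> x = a \<odot>\<^bsub>M\<^esub> (b \<odot>\<^bsub>M\<^esub> x)"
    and smult_one [simp]: "x \<in> carrier M \<Longrightarrow> \<one> \<odot>\<^bsub>M\<^esub> x = x"

definition self_module :: "('a, 'c) ring_scheme \<Rightarrow> ('a, 'a) module" where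
  "self_module R = \<lparr>carrier = carrier R, monoid.mult = monoid.mult R, one = one R, ring.zero = ring.zero R,
     add = add R, smult = monoid.mult R\<rparr>"


section \<open>Gradings\<close>

text \<open>
  A \<open>\<int>\<close>-grading is given by the family \<open>D\<close> of its homogeneous parts; the additive group is
  their internal direct sum.
\<close>

definition homogeneous_decomposition ::
    "('m, 'c) ring_scheme \<Rightarrow> (int \<Rightarrow> 'm set) \<Rightarrow> 'm \<Rightarrow> (int \<Rightarrow> 'm) \<Rightarrow> bool" where
  "homogeneous_decomposition M D x f \<longleftrightarrow>
     (\<forall>n. f n \<in> D n) \<and> finite {n. f n \<noteq> \<zero>\<^bsub>M\<^esub>} \<and> x = (\<Oplus>\<^bsub>M\<^esub>n\<in>{n. f n \<noteq> \<zero>\<^bsub>M\<^esub>}. f n)"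

definition grading :: "('m, 'c) ring_scheme \<Rightarrow> (int \<Rightarrow> 'm set) \<Rightarrow> bool" where
  "grading M D \<longleftrightarrow> (\<forall>n. additive_subgroup (D n) M) \<and>
     (\<forall>x\<in>carrier M. \<exists>!f. homogeneous_decomposition M D x f)"

definition homogeneous :: "(int \<Rightarrow> 'm set) \<Rightarrow> 'm \<Rightarrow> bool" where
  "homogeneous D x \<longleftrightarrow> (\<exists>n. x \<in> D n)"

definition graded_ring :: "('a, 'c) ring_scheme \<Rightarrow> (int \<Rightarrow> 'a set) \<Rightarrow> bool" where
  "graded_ring R RD \<longleftrightarrow> ring R \<and> grading R RD \<and>
     (\<forall>i j. \<forall>r\<in>RD i. \<forall>s\<in>RD j. r \<otimes>\<^bsub>R\<^esub> s \<in> RD (i + j))"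

definition graded_left_module ::
    "('a, 'c) ring_scheme \<Rightarrow> (int \<Rightarrow> 'a set) \<Rightarrow> ('a, 'm, 'd) module_scheme \<Rightarrow> (int \<Rightarrow> 'm set) \<Rightarrow> bool" where
  "graded_left_module R RD M MD \<longleftrightarrow> left_module R M \<and> grading M MD \<and>
     (\<forall>i j. \<forall>r\<in>RD i. \<forall>x\<in>MD j. r \<odot>\<^bsub>M\<^esub> x \<in> MD (i + j))"

definition graded_subgroup ::
    "('m, 'c) ring_scheme \<Rightarrow> (int \<Rightarrow> 'm set) \<Rightarrow> 'm set \<Rightarrow> bool" where
  "graded_subgroup M MD H \<longleftrightarrow> additive_subgroup H M \<and>
     (\<forall>x\<in>H. \<exists>f. homogeneous_decomposition M MD x f \<and> range f \<subseteq> H)"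

definition graded_submodule ::
    "('a, 'c) ring_scheme \<Rightarrow> ('a, 'm, 'd) module_scheme \<Rightarrow> (int \<Rightarrow> 'm set) \<Rightarrow> 'm set \<Rightarrow> bool" where
  "graded_submodule R M MD H \<longleftrightarrow> submodule H R M \<and> graded_subgroup M MD H"

definition homogeneous_left_ideal ::
    "('a, 'c) ring_scheme \<Rightarrow> (int \<Rightarrow> 'a set) \<Rightarrow> 'a set \<Rightarrow> bool" where
  "homogeneous_left_ideal R RD I \<longleftrightarrow> graded_submodule R (self_module R) RD I"

definition graded_iso ::
    "('a, 'c) ring_scheme \<Rightarrow> ('a, 'm, 'd) module_scheme \<Rightarrow> (int \<Rightarrow> 'm set) \<Rightarrow>
     ('a, 'n, 'e) module_scheme \<Rightarrow> (int \<Rightarrow> 'n set) \<Rightarrow> ('m \<Rightarrow> 'n) set" where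
  "graded_iso R M MD N ND = {h. bij_betw h (carrier M) (carrier N) \<and>
     (\<forall>x\<in>carrier M. \<forall>y\<in>carrier M. h (x \<oplus>\<^bsub>M\<^esub> y) = h x \<oplus>\<^bsub>N\<^esub> h y) \<and>
     (\<forall>r\<in>carrier R. \<forall>x\<in>carrier M. h (r \<odot>\<^bsub>M\<^esub> x) = r \<odot>\<^bsub>N\<^esub> h x) \<and>
     (\<forall>n. h ` MD n \<subseteq> ND n)}"


section \<open>Suspensions, coproducts, quotients\<close>

text \<open>
  The \<open>d\<close>-fold suspension keeps the module and shifts the grading. (The convention with a sign
  \<open>r \<cdot> \<Sigma>x = (-1)\<^sup>|\<^sup>r\<^sup>| \<Sigma>(r x)\<close> for odd \<open>d\<close> gives an isomorphic graded module, via
  \<open>x \<mapsto> (-1)\<^sup>|\<^sup>x\<^sup>| x\<close>.)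
\<close>

definition suspension :: "int \<Rightarrow> (int \<Rightarrow> 'm set) \<Rightarrow> int \<Rightarrow> 'm set" where
  "suspension d MD = (\<lambda>n. MD (n - d))"

definition coproduct_module ::
    "'i set \<Rightarrow> ('i \<Rightarrow> ('a, 'm, 'd) module_scheme) \<Rightarrow> ('a, 'i \<Rightarrow> 'm) module" where
  "coproduct_module I M = \<lparr>
     carrier = {f \<in> (\<Pi>\<^sub>E i\<in>I. carrier (M i)). finite {i \<in> I. f i \<noteq> \<zero>\<^bsub>M i\<^esub>}},
     monoid.mult = undefined, one = undefined,
     ring.zero = (\<lambda>i\<in>I. \<zero>\<^bsub>M i\<^esub>),
     add = (\<lambda>f g. \<lambda>i\<in>I. f i \<oplus>\<^bsub>M i\<^esub> g i),
     smult = (\<lambda>r f. \<lambda>i\<in>I. r \<odot>\<^bsub>M i\<^esub> f i)\<rparr>"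

definition coproduct_grading ::
    "'i set \<Rightarrow> ('i \<Rightarrow> ('a, 'm, 'd) module_scheme) \<Rightarrow> ('i \<Rightarrow> int \<Rightarrow> 'm set) \<Rightarrow> int \<Rightarrow> ('i \<Rightarrow> 'm) set" where
  "coproduct_grading I M MD = (\<lambda>n. {f \<in> carrier (coproduct_module I M). \<forall>i\<in>I. f i \<in> MD i n})"

definition quotient_module ::
    "('a, 'm, 'd) module_scheme \<Rightarrow> 'm set \<Rightarrow> ('a, 'm set) module" where
  "quotient_module M L = \<lparr>
     carrier = a_rcosets\<^bsub>M\<^esub> L,
     monoid.mult = undefined, one = undefined,
     ring.zero = L,
     add = set_add M,
     smult = (\<lambda>r A. \<Union>x\<in>A. L +>\<^bsub>M\<^esub> (r \<odot>\<^bsub>M\<^esub> x))\<rparr>"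

definition quotient_grading ::
    "('a, 'm, 'd) module_scheme \<Rightarrow> (int \<Rightarrow> 'm set) \<Rightarrow> 'm set \<Rightarrow> int \<Rightarrow> 'm set set" where
  "quotient_grading M MD L = (\<lambda>n. (\<lambda>x. L +>\<^bsub>M\<^esub> x) ` MD n)"


section \<open>Rational, distinguished, torsion\<close>

text \<open>
  The type argument is the type from which the index set of the coproduct is taken, since one
  cannot quantify over all types inside a formula. Index sets in \<open>'m \<times> nat\<close> always suffice: a
  module is generated by its homogeneous elements, and each of them involves only finitely many
  summands. Being rational with respect to coproducts of arbitrary size therefore amounts to
  \<open>rational TYPE('m \<times> nat)\<close>; that \<open>rational TYPE('i)\<close> implies this for every \<open>'i\<close> is part of the
  theorem.
\<close>

definition rational ::
    "'i itself \<Rightarrow> ('a, 'c) ring_scheme \<Rightarrow> ('a, 't, 'e) module_scheme \<Rightarrow> (int \<Rightarrow> 't set) \<Rightarrow>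
     ('a, 'm, 'd) module_scheme \<Rightarrow> (int \<Rightarrow> 'm set) \<Rightarrow> bool" where
  "rational T R \<Theta> \<Theta>D M MD \<longleftrightarrow>
     (\<exists>(I :: 'i set) (d :: 'i \<Rightarrow> int) L K.
        let C = coproduct_module I (\<lambda>i. \<Theta>);
            CD = coproduct_grading I (\<lambda>i. \<Theta>) (\<lambda>i. suspension (d i) \<Theta>D);
            Q = quotient_module C L;
            QD = quotient_grading C CD L
        in graded_submodule R C CD L \<and>
           graded_submodule R Q QD K \<and>
           graded_iso R M MD (Q\<lparr>carrier := K\<rparr>) (\<lambda>n. QD n \<inter> K) \<noteq> {})"

definition left_ann :: "('a, 'c) ring_scheme \<Rightarrow> ('a, 'm, 'd) module_scheme \<Rightarrow> 'm \<Rightarrow> 'a set" where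
  "left_ann R M m = {r \<in> carrier R. r \<odot>\<^bsub>M\<^esub> m = \<zero>\<^bsub>M\<^esub>}"

definition strongly_distinguished ::
    "('a, 'c) ring_scheme \<Rightarrow> (int \<Rightarrow> 'a set) \<Rightarrow> ('a, 't, 'e) module_scheme \<Rightarrow> (int \<Rightarrow> 't set) \<Rightarrow>
     'a set \<Rightarrow> bool" where
  "strongly_distinguished R RD \<Theta> \<Theta>D I \<longleftrightarrow> homogeneous_left_ideal R RD I \<and>
     (\<exists>\<theta>. homogeneous \<Theta>D \<theta> \<and> \<theta> \<noteq> \<zero>\<^bsub>\<Theta>\<^esub> \<and> I = left_ann R \<Theta> \<theta>)"

definition dist_bar ::
    "('a, 'c) ring_scheme \<Rightarrow> (int \<Rightarrow> 'a set) \<Rightarrow> ('a, 't, 'e) module_scheme \<Rightarrow> (int \<Rightarrow> 't set) \<Rightarrow>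
     'a set set" where
  "dist_bar R RD \<Theta> \<Theta>D =
     {carrier R \<inter> \<Inter>F | F. finite F \<and> (\<forall>I\<in>F. strongly_distinguished R RD \<Theta> \<Theta>D I)}"

definition distinguished ::
    "('a, 'c) ring_scheme \<Rightarrow> (int \<Rightarrow> 'a set) \<Rightarrow> ('a, 't, 'e) module_scheme \<Rightarrow> (int \<Rightarrow> 't set) \<Rightarrow>
     'a set \<Rightarrow> bool" where
  "distinguished R RD \<Theta> \<Theta>D J \<longleftrightarrow> homogeneous_left_ideal R RD J \<and>
     (\<exists>I\<in>dist_bar R RD \<Theta> \<Theta>D. I \<subseteq> J)"

definition h0_dist ::
    "('a, 'c) ring_scheme \<Rightarrow> (int \<Rightarrow> 'a set) \<Rightarrow> ('a, 't, 'e) module_scheme \<Rightarrow> (int \<Rightarrow> 't set) \<Rightarrow>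
     ('a, 'm, 'd) module_scheme \<Rightarrow> (int \<Rightarrow> 'm set) \<Rightarrow> 'm set" where
  "h0_dist R RD \<Theta> \<Theta>D M MD =
     graded_subgroup M MD hull
       {m. homogeneous MD m \<and> (\<exists>I\<in>dist_bar R RD \<Theta> \<Theta>D. \<forall>r\<in>I. r \<odot>\<^bsub>M\<^esub> m = \<zero>\<^bsub>M\<^esub>)}"

definition H0_dist ::
    "('a, 'c) ring_scheme \<Rightarrow> (int \<Rightarrow> 'a set) \<Rightarrow> ('a, 't, 'e) module_scheme \<Rightarrow> (int \<Rightarrow> 't set) \<Rightarrow>
     ('a, 'm, 'd) module_scheme \<Rightarrow> (int \<Rightarrow> 'm set) \<Rightarrow> 'm set" where
  "H0_dist R RD \<Theta> \<Theta>D M MD = graded_submodule R M MD hull h0_dist R RD \<Theta> \<Theta>D M MD"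

definition distinguished_torsion ::
    "('a, 'c) ring_scheme \<Rightarrow> (int \<Rightarrow> 'a set) \<Rightarrow> ('a, 't, 'e) module_scheme \<Rightarrow> (int \<Rightarrow> 't set) \<Rightarrow>
     ('a, 'm, 'd) module_scheme \<Rightarrow> (int \<Rightarrow> 'm set) \<Rightarrow> bool" where
  "distinguished_torsion R RD \<Theta> \<Theta>D M MD \<longleftrightarrow>
     (let H = H0_dist R RD \<Theta> \<Theta>D M MD
      in (\<lambda>m. m) \<in> graded_iso R (M\<lparr>carrier := H\<rparr>) (\<lambda>n. MD n \<inter> H) M MD)"

end

theory Submission
  imports Defs
begin

text \<open>
  The condition on annihilators is easier to use in terms of elements: the
  intersections of finitely many strongly distinguished left ideals are the common annihilators of
  finite sets of homogeneous elements of \<open>\<Theta>\<close> (lemma \<open>dist_bar_iff\<close>). So a homogeneous \<open>m\<close> has a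
  distinguished annihilator iff some finite set \<open>S\<close> of homogeneous elements of \<open>\<Theta>\<close> has the property
  that everything annihilating \<open>S\<close> annihilates \<open>m\<close>.

  If \<open>M\<close> is rational, the image of \<open>m\<close> in the quotient \<open>C / L\<close> of a coproduct \<open>C\<close> of suspensions of
  \<open>\<Theta>\<close> is represented by a homogeneous family with finitely many nonzero entries, and these entries
  form such a set \<open>S\<close> (lemma \<open>rational_imp_distinguished\<close>). This argument
  applies to index sets of any type; combined with the converse it shows that pairs of an element of
  \<open>M\<close> and a natural number provide enough indices.

  Conversely (lemma \<open>distinguished_imp_rational\<close>), choose for every homogeneous \<open>m\<close> a finite sequence
  \<open>t m 0, \<dots>, t m (N m - 1)\<close> enumerating such a set. Let \<open>C\<close> be the coproduct of copies of \<open>\<Theta>\<close>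
  indexed by the pairs \<open>(m, k)\<close> with \<open>k < N m\<close>, where the copy at \<open>(m, k)\<close> is shifted so that
  \<open>t m k\<close> acquires the degree of \<open>m\<close>. The free graded module \<open>F\<close> on the homogeneous elements of \<open>M\<close>
  maps onto \<open>M\<close> by \<open>\<phi>\<close>, and it maps to \<open>C\<close> by \<open>\<psi>\<close>, which sends the basis element of \<open>m\<close> to the
  family \<open>(t m k)\<close>. If \<open>\<psi> u = 0\<close>, then each coefficient \<open>u m\<close> annihilates all \<open>t m k\<close>, hence \<open>m\<close>, so
  \<open>\<phi> u = 0\<close>. With \<open>L = \<psi>(ker \<phi>)\<close>, the composite of \<open>\<psi>\<close> with the projection \<open>C \<rightarrow> C / L\<close> therefore
  has the same kernel as \<open>\<phi>\<close>, and its image is a graded submodule of \<open>C / L\<close> isomorphic to \<open>M\<close>.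

  For torsion, the elements of \<open>M\<close> all of whose components have a distinguished annihilator form a
  graded submodule (lemma \<open>graded_submodule_torsion_part\<close>): annihilator conditions for a sum are
  combined by uniting the finite sets, and those for \<open>a m\<close> with \<open>a\<close> homogeneous are obtained by
  replacing \<open>S\<close> with \<open>a S\<close>. So no new homogeneous elements appear when the submodule generated by the
  torsion elements is formed, and this submodule is \<open>M\<close> iff all homogeneous elements are torsion.
\<close>

section \<open>Additive maps and homogeneous decompositions\<close>

lemma additive_map_abelian_group_hom:
  assumes "abelian_group G" "abelian_group H" "h \<in> carrier G \<rightarrow> carrier H"
    and "\<And>x y. x \<in> carrier G \<Longrightarrow> y \<in> carrier G \<Longrightarrow> h (x \<oplus>\<^bsub>G\<^esub> y) = h x \<oplus>\<^bsub>H\<^esub> h y"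
  shows "abelian_group_hom G H h"
  using assms
  by (auto intro!: abelian_group_homI group_hom.intro group_hom_axioms.intro
      abelian_group.a_group homI)

lemma (in abelian_group_hom) hom_finsum:
  assumes "f \<in> A \<rightarrow> carrier G"
  shows "h (finsum G f A) = (\<Oplus>\<^bsub>H\<^esub>i\<in>A. h (f i))"
  using assms
proof (induction A rule: infinite_finite_induct)
  case (insert a A)
  then have "f \<in> A \<rightarrow> carrier G" "f a \<in> carrier G" by auto
  with insert show ?case
    by (simp add: G.finsum_insert H.finsum_insert Pi_def)
qed auto

lemma (in abelian_group_hom) eq_iff_kernel:
  assumes "x \<in> carrier G" "y \<in> carrier G"
  shows "h x = h y \<longleftrightarrow> h (x \<ominus>\<^bsub>G\<^esub> y) = \<zero>\<^bsub>H\<^esub>"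
proof -
  have "h (x \<ominus>\<^bsub>G\<^esub> y) = h x \<ominus>\<^bsub>H\<^esub> h y" using assms by (simp add: a_minus_def)
  then show ?thesis using assms H.add.inv_equality[of "h x" "\<ominus>\<^bsub>H\<^esub> h y"]
    by (auto simp: a_minus_def H.r_neg)
qed

lemma grading_closed: "grading M MD \<Longrightarrow> x \<in> MD n \<Longrightarrow> x \<in> carrier M"
  unfolding grading_def using additive_subgroup.a_subset[of "MD n" M] by auto

lemma grading_zero: "grading M MD \<Longrightarrow> \<zero>\<^bsub>M\<^esub> \<in> MD n"
  unfolding grading_def by (simp add: additive_subgroup.zero_closed)

lemma homogeneous_decomposition_unique:
  assumes "grading M MD" "x \<in> carrier M"
    "homogeneous_decomposition M MD x f" "homogeneous_decomposition M MD x g"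
  shows "f = g"
  using assms unfolding grading_def by (metis (no_types))

text \<open>
  Summing over the exact support is awkward when supports shrink, as under homomorphisms and
  addition; any larger finite set of degrees gives the same sum.
\<close>

lemma homogeneous_decomposition_superset:
  assumes "abelian_group M" "f \<in> UNIV \<rightarrow> carrier M"
    and "finite A" "{n. f n \<noteq> \<zero>\<^bsub>M\<^esub>} \<subseteq> A"
  shows "homogeneous_decomposition M MD x f \<longleftrightarrow> (\<forall>n. f n \<in> MD n) \<and> x = finsum M f A"
proof -
  interpret abelian_group M by fact
  have "finsum M f {n. f n \<noteq> \<zero>\<^bsub>M\<^esub>} = finsum M f A"
    using assms by (intro add.finprod_mono_neutral_cong_left) auto
  then show ?thesis
    using assms(3,4) unfolding homogeneous_decomposition_def by (auto intro: finite_subset)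
qed

lemma homogeneous_decomposition_single:
  assumes "abelian_group M" "grading M MD" "x \<in> MD n"
  shows "homogeneous_decomposition M MD x (\<lambda>k. if k = n then x else \<zero>\<^bsub>M\<^esub>)"
proof -
  interpret abelian_group M by fact
  have x: "x \<in> carrier M" using grading_closed[OF assms(2,3)] .
  have "homogeneous_decomposition M MD x (\<lambda>k. if k = n then x else \<zero>\<^bsub>M\<^esub>) \<longleftrightarrow>
      (\<forall>k. (if k = n then x else \<zero>\<^bsub>M\<^esub>) \<in> MD k) \<and>
      x = finsum M (\<lambda>k. if k = n then x else \<zero>\<^bsub>M\<^esub>) {n}"
    using x by (intro homogeneous_decomposition_superset[OF assms(1)]) auto
  then show ?thesis
    using x assms by (simp add: finsum_insert grading_zero)
qed

lemma homogeneous_decomposition_image: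
  assumes "abelian_group_hom M N h"
    and f: "homogeneous_decomposition M MD x f" "f \<in> UNIV \<rightarrow> carrier M"
    and deg: "\<And>n. h ` MD n \<subseteq> ND n"
  shows "homogeneous_decomposition N ND (h x) (\<lambda>n. h (f n))"
proof -
  interpret abelian_group_hom M N h by fact
  let ?A = "{n. f n \<noteq> \<zero>\<^bsub>M\<^esub>}"
  have A: "finite ?A" and x: "x = finsum M f ?A" and fn: "\<And>n. f n \<in> MD n"
    using f(1) unfolding homogeneous_decomposition_def by auto
  have fc: "f n \<in> carrier M" for n using f(2) by blast
  have "homogeneous_decomposition N ND (h x) (\<lambda>n. h (f n)) \<longleftrightarrow>
      (\<forall>n. h (f n) \<in> ND n) \<and> h x = (\<Oplus>\<^bsub>N\<^esub>n\<in>?A. h (f n))"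
    using fc A by (intro homogeneous_decomposition_superset[OF H.abelian_group_axioms]) auto
  then show ?thesis
    using fn deg hom_finsum[of f ?A] fc unfolding x by auto
qed

lemma homogeneous_decomposition_carrier:
  assumes "grading M MD" "homogeneous_decomposition M MD x f"
  shows "f \<in> UNIV \<rightarrow> carrier M"
  using assms(2) grading_closed[OF assms(1)] unfolding homogeneous_decomposition_def by auto

lemma homogeneous_decomposition_exists:
  assumes "grading M MD" "x \<in> carrier M"
  obtains f where "homogeneous_decomposition M MD x f" "f \<in> UNIV \<rightarrow> carrier M"
proof -
  have "\<exists>!f. homogeneous_decomposition M MD x f" using assms unfolding grading_def by simp
  then obtain f where "homogeneous_decomposition M MD x f" by (rule ex1E)
  from that[OF this homogeneous_decomposition_carrier[OF assms(1) this]] show thesis .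
qed

text \<open>
  Meant for proofs that \<open>H\<close> is a submodule, where closure under negation only comes out at the end, as
  a consequence of closure under scalar multiplication.
\<close>

lemma (in abelian_group) finsum_in_subset:
  assumes "H \<subseteq> carrier G" "\<zero> \<in> H" "\<And>x y. x \<in> H \<Longrightarrow> y \<in> H \<Longrightarrow> x \<oplus> y \<in> H"
    and "\<And>i. i \<in> A \<Longrightarrow> f i \<in> H"
  shows "finsum G f A \<in> H"
  using assms(4)
proof (induction A rule: infinite_finite_induct)
  case (insert a A)
  then have "f \<in> A \<rightarrow> carrier G" "f a \<in> carrier G" using assms(1) by auto
  with insert assms(3) show ?case by (simp add: finsum_insert)
qed (use assms(2) in \<open>simp_all add: finsum_infinite\<close>)

lemma additive_subgroup_finsum_closed:
  assumes "abelian_group M" "additive_subgroup H M" "\<And>i. i \<in> A \<Longrightarrow> f i \<in> H"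
  shows "finsum M f A \<in> H"
proof -
  interpret abelian_group M by fact
  interpret additive_subgroup H M by fact
  show ?thesis using a_subset assms(3) by (intro finsum_in_subset) auto
qed

lemma additive_subgroup_containing_homogeneous:
  assumes "abelian_group M" "grading M MD" "additive_subgroup H M"
    and "\<And>x. homogeneous MD x \<Longrightarrow> x \<in> H"
  shows "carrier M \<subseteq> H"
proof
  fix x assume "x \<in> carrier M"
  then obtain f where f: "homogeneous_decomposition M MD x f"
    using homogeneous_decomposition_exists[OF assms(2)] by metis
  then have "f n \<in> H" for n
    using assms(4) unfolding homogeneous_decomposition_def homogeneous_def by blast
  then have "finsum M f {n. f n \<noteq> \<zero>\<^bsub>M\<^esub>} \<in> H"
    by (intro additive_subgroup_finsum_closed[OF assms(1,3)]) auto
  with f show "x \<in> H"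
    unfolding homogeneous_decomposition_def by simp
qed


section \<open>Left modules\<close>

lemma (in left_module) smult_r_hom:
  assumes "a \<in> carrier R"
  shows "abelian_group_hom M M (\<lambda>x. a \<odot>\<^bsub>M\<^esub> x)"
  using assms by (intro additive_map_abelian_group_hom M.abelian_group_axioms) (auto simp: smult_r_distr)

lemma (in left_module) smult_l_hom:
  assumes "x \<in> carrier M"
  shows "abelian_group_hom R M (\<lambda>a. a \<odot>\<^bsub>M\<^esub> x)"
  using assms
  by (intro additive_map_abelian_group_hom M.abelian_group_axioms R.abelian_group_axioms)
    (auto simp: smult_l_distr)

lemma (in left_module) smult_r_null: "a \<in> carrier R \<Longrightarrow> a \<odot>\<^bsub>M\<^esub> \<zero>\<^bsub>M\<^esub> = \<zero>\<^bsub>M\<^esub>"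
  using abelian_group_hom.hom_zero[OF smult_r_hom] .

lemma (in left_module) smult_l_null: "x \<in> carrier M \<Longrightarrow> \<zero> \<odot>\<^bsub>M\<^esub> x = \<zero>\<^bsub>M\<^esub>"
  using abelian_group_hom.hom_zero[OF smult_l_hom] .

text \<open>Closure under negation follows from \<open>- x = (- 1) x\<close>.\<close>

lemma (in left_module) submoduleI:
  assumes "H \<subseteq> carrier M" "\<zero>\<^bsub>M\<^esub> \<in> H"
    and add: "\<And>x y. x \<in> H \<Longrightarrow> y \<in> H \<Longrightarrow> x \<oplus>\<^bsub>M\<^esub> y \<in> H"
    and smult: "\<And>a x. a \<in> carrier R \<Longrightarrow> x \<in> H \<Longrightarrow> a \<odot>\<^bsub>M\<^esub> x \<in> H"
  shows "submodule H R M"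
proof -
  have "\<ominus>\<^bsub>M\<^esub> x \<in> H" if "x \<in> H" for x
  proof -
    have x: "x \<in> carrier M" using that assms(1) by blast
    have "(\<ominus> \<one>) \<odot>\<^bsub>M\<^esub> x = \<ominus>\<^bsub>M\<^esub> x"
      using abelian_group_hom.hom_a_inv[OF smult_l_hom[OF x] R.one_closed] x by simp
    then show ?thesis using smult[OF _ that, of "\<ominus> \<one>"] by simp
  qed
  then show ?thesis
    using assms
    by (auto intro!: submodule.intro subgroup.intro submodule_axioms.intro simp flip: a_inv_def)
qed

text \<open>The axioms are equations between elements, so they pass to every surjective image.\<close>

lemma left_module_surjective_image:
  assumes "left_module R C" and surj: "p ` carrier C = carrier Q"
    and add: "\<And>x y. x \<in> carrier C \<Longrightarrow> y \<in> carrier C \<Longrightarrow> p (x \<oplus>\<^bsub>C\<^esub> y) = p x \<oplus>\<^bsub>Q\<^esub> p y"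
    and zero: "p \<zero>\<^bsub>C\<^esub> = \<zero>\<^bsub>Q\<^esub>"
    and smult: "\<And>r x. r \<in> carrier R \<Longrightarrow> x \<in> carrier C \<Longrightarrow> p (r \<odot>\<^bsub>C\<^esub> x) = r \<odot>\<^bsub>Q\<^esub> p x"
  shows "left_module R Q"
proof -
  interpret C: left_module R C by fact
  have img: "p x \<in> carrier Q" if "x \<in> carrier C" for x using that surj by blast
  have rep: thesis if "y \<in> carrier Q" "\<And>x. x \<in> carrier C \<Longrightarrow> y = p x \<Longrightarrow> thesis" for y thesis
    using that surj by blast
  have "abelian_group Q"
  proof (rule abelian_groupI)
    show "\<zero>\<^bsub>Q\<^esub> \<in> carrier Q" using img[OF C.M.zero_closed] zero by simp
  next
    fix x y assume x: "x \<in> carrier Q" and y: "y \<in> carrier Q"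
    obtain a where a: "a \<in> carrier C" "x = p a" using rep[OF x] .
    obtain b where b: "b \<in> carrier C" "y = p b" using rep[OF y] .
    show "x \<oplus>\<^bsub>Q\<^esub> y \<in> carrier Q"
      using img[OF C.M.a_closed[OF a(1) b(1)]] add[OF a(1) b(1)] a b by simp
    show "x \<oplus>\<^bsub>Q\<^esub> y = y \<oplus>\<^bsub>Q\<^esub> x"
      using add[OF a(1) b(1)] add[OF b(1) a(1)] C.M.a_comm[OF a(1) b(1)] a b by simp
    fix z assume z: "z \<in> carrier Q"
    obtain c where c: "c \<in> carrier C" "z = p c" using rep[OF z] .
    have "p (a \<oplus>\<^bsub>C\<^esub> b \<oplus>\<^bsub>C\<^esub> c) = p (a \<oplus>\<^bsub>C\<^esub> (b \<oplus>\<^bsub>C\<^esub> c))"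
      using C.M.a_assoc[OF a(1) b(1) c(1)] by simp
    then show "x \<oplus>\<^bsub>Q\<^esub> y \<oplus>\<^bsub>Q\<^esub> z = x \<oplus>\<^bsub>Q\<^esub> (y \<oplus>\<^bsub>Q\<^esub> z)"
      using a b c by (simp add: add)
  next
    fix x assume x: "x \<in> carrier Q"
    obtain a where a: "a \<in> carrier C" "x = p a" using rep[OF x] .
    show "\<zero>\<^bsub>Q\<^esub> \<oplus>\<^bsub>Q\<^esub> x = x"
      using add[OF C.M.zero_closed a(1)] a zero by simp
    show "\<exists>y\<in>carrier Q. y \<oplus>\<^bsub>Q\<^esub> x = \<zero>\<^bsub>Q\<^esub>"
      using add[OF C.M.a_inv_closed[OF a(1)] a(1)] img[OF C.M.a_inv_closed[OF a(1)]] a zero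
      by (auto simp: C.M.l_neg)
  qed
  then show ?thesis
  proof (intro left_module.intro left_module_axioms.intro C.R.ring_axioms)
    fix a x assume a: "a \<in> carrier R" and x: "x \<in> carrier Q"
    obtain u where u: "u \<in> carrier C" "x = p u" using rep[OF x] .
    show "a \<odot>\<^bsub>Q\<^esub> x \<in> carrier Q"
      using img[OF C.smult_closed[OF a u(1)]] smult[OF a u(1)] u by simp
    fix b assume b: "b \<in> carrier R"
    have "p ((a \<oplus>\<^bsub>R\<^esub> b) \<odot>\<^bsub>C\<^esub> u) = p (a \<odot>\<^bsub>C\<^esub> u \<oplus>\<^bsub>C\<^esub> b \<odot>\<^bsub>C\<^esub> u)"
      using C.smult_l_distr[OF a b u(1)] by simp
    then show "(a \<oplus>\<^bsub>R\<^esub> b) \<odot>\<^bsub>Q\<^esub> x = a \<odot>\<^bsub>Q\<^esub> x \<oplus>\<^bsub>Q\<^esub> b \<odot>\<^bsub>Q\<^esub> x"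
      using a b u by (simp add: smult add)
    have "p ((a \<otimes>\<^bsub>R\<^esub> b) \<odot>\<^bsub>C\<^esub> u) = p (a \<odot>\<^bsub>C\<^esub> (b \<odot>\<^bsub>C\<^esub> u))"
      using C.smult_assoc[OF a b u(1)] by simp
    then show "(a \<otimes>\<^bsub>R\<^esub> b) \<odot>\<^bsub>Q\<^esub> x = a \<odot>\<^bsub>Q\<^esub> (b \<odot>\<^bsub>Q\<^esub> x)"
      using a b u by (simp add: smult)
  next
    fix a x y assume a: "a \<in> carrier R" and x: "x \<in> carrier Q" and y: "y \<in> carrier Q"
    obtain u where u: "u \<in> carrier C" "x = p u" using rep[OF x] .
    obtain v where v: "v \<in> carrier C" "y = p v" using rep[OF y] .
    have "p (a \<odot>\<^bsub>C\<^esub> (u \<oplus>\<^bsub>C\<^esub> v)) = p (a \<odot>\<^bsub>C\<^esub> u \<oplus>\<^bsub>C\<^esub> a \<odot>\<^bsub>C\<^esub> v)"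
      using C.smult_r_distr[OF a u(1) v(1)] by simp
    then show "a \<odot>\<^bsub>Q\<^esub> (x \<oplus>\<^bsub>Q\<^esub> y) = a \<odot>\<^bsub>Q\<^esub> x \<oplus>\<^bsub>Q\<^esub> a \<odot>\<^bsub>Q\<^esub> y"
      using a u v by (simp add: smult add)
  next
    fix x assume x: "x \<in> carrier Q"
    obtain u where u: "u \<in> carrier C" "x = p u" using rep[OF x] .
    show "\<one>\<^bsub>R\<^esub> \<odot>\<^bsub>Q\<^esub> x = x"
      using smult[OF C.R.one_closed u(1)] u by simp
  qed
qed


section \<open>Homomorphisms of graded modules\<close>

definition graded_hom ::
    "('a, 'c) ring_scheme \<Rightarrow> ('a, 'm, 'd) module_scheme \<Rightarrow> (int \<Rightarrow> 'm set) \<Rightarrow>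
     ('a, 'n, 'e) module_scheme \<Rightarrow> (int \<Rightarrow> 'n set) \<Rightarrow> ('m \<Rightarrow> 'n) set" where
  "graded_hom R M MD N ND = {h \<in> carrier M \<rightarrow> carrier N.
     (\<forall>x\<in>carrier M. \<forall>y\<in>carrier M. h (x \<oplus>\<^bsub>M\<^esub> y) = h x \<oplus>\<^bsub>N\<^esub> h y) \<and>
     (\<forall>r\<in>carrier R. \<forall>x\<in>carrier M. h (r \<odot>\<^bsub>M\<^esub> x) = r \<odot>\<^bsub>N\<^esub> h x) \<and>
     (\<forall>n. h ` MD n \<subseteq> ND n)}"

lemma graded_hom_abelian_group_hom:
  assumes "h \<in> graded_hom R M MD N ND" "left_module R M" "left_module R N"
  shows "abelian_group_hom M N h"
  using assms unfolding graded_hom_def left_module_def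
  by (simp add: additive_map_abelian_group_hom)

lemma graded_hom_comp:
  assumes "g \<in> graded_hom R M MD N ND" "h \<in> graded_hom R N ND P PD"
  shows "(\<lambda>x. h (g x)) \<in> graded_hom R M MD P PD"
  using assms unfolding graded_hom_def by (simp add: Pi_iff image_subset_iff)

lemma graded_left_moduleD:
  assumes "graded_left_module R RD M MD"
  shows "left_module R M" "grading M MD" "abelian_group M"
  using assms unfolding graded_left_module_def left_module_def by auto

lemma submodule_additive_subgroup: "submodule H R M \<Longrightarrow> additive_subgroup H M"
  unfolding submodule_def additive_subgroup_def by blast

lemma graded_submodule_carrier:
  assumes "graded_left_module R RD M MD"
  shows "graded_submodule R M MD (carrier M)"
proof -
  interpret left_module R M using assms by (rule graded_left_moduleD)
  have s: "submodule (carrier M) R M" by (rule submoduleI) auto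
  have "\<exists>f. homogeneous_decomposition M MD x f \<and> range f \<subseteq> carrier M" if "x \<in> carrier M" for x
  proof -
    obtain f where "homogeneous_decomposition M MD x f" "f \<in> UNIV \<rightarrow> carrier M"
      using homogeneous_decomposition_exists[OF graded_left_moduleD(2)[OF assms] \<open>x \<in> carrier M\<close>] .
    then show ?thesis by (auto simp: Pi_iff image_subset_iff)
  qed
  with s show ?thesis
    unfolding graded_submodule_def graded_subgroup_def by (simp add: submodule_additive_subgroup)
qed

text \<open>
  A homomorphism of graded modules maps the components of an element to the components of its
  image. Hence an element of the kernel has all its components there, because decompositions in
  the target are unique.
\<close>

lemma graded_submodule_kernel:
  assumes M: "graded_left_module R RD M MD" and N: "graded_left_module R RD N ND"
    and h: "h \<in> graded_hom R M MD N ND"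
  shows "graded_submodule R M MD {x \<in> carrier M. h x = \<zero>\<^bsub>N\<^esub>}"
proof -
  interpret M: left_module R M using M by (rule graded_left_moduleD)
  interpret N: left_module R N using N by (rule graded_left_moduleD)
  interpret abelian_group_hom M N h
    by (rule graded_hom_abelian_group_hom[OF h M.left_module_axioms N.left_module_axioms])
  let ?K = "{x \<in> carrier M. h x = \<zero>\<^bsub>N\<^esub>}"
  have s: "submodule ?K R M"
    by (rule M.submoduleI) (use h in \<open>auto simp: graded_hom_def N.smult_r_null\<close>)
  have "\<exists>f. homogeneous_decomposition M MD x f \<and> range f \<subseteq> ?K" if x: "x \<in> ?K" for x
  proof -
    have "x \<in> carrier M" using x by simp
    then obtain f where f: "homogeneous_decomposition M MD x f" and fc: "f \<in> UNIV \<rightarrow> carrier M"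
      using homogeneous_decomposition_exists[OF graded_left_moduleD(2)[OF M]] by metis
    have 1: "homogeneous_decomposition N ND (h x) (\<lambda>n. h (f n))"
      using h by (intro homogeneous_decomposition_image[OF abelian_group_hom_axioms f fc])
        (auto simp: graded_hom_def)
    have 2: "homogeneous_decomposition N ND (h x) (\<lambda>n. if n = 0 then \<zero>\<^bsub>N\<^esub> else \<zero>\<^bsub>N\<^esub>)"
      using x homogeneous_decomposition_single[OF N.M.abelian_group_axioms graded_left_moduleD(2)[OF N]
          grading_zero[OF graded_left_moduleD(2)[OF N]], of 0] by simp
    have "h x \<in> carrier N" using x by simp
    from homogeneous_decomposition_unique[OF graded_left_moduleD(2)[OF N] this 1 2]
    have "range f \<subseteq> ?K" using fc by (auto simp: fun_eq_iff)
    with f show ?thesis by (intro exI[of _ f]) simp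
  qed
  with s show ?thesis
    unfolding graded_submodule_def graded_subgroup_def by (simp add: submodule_additive_subgroup)
qed

lemma graded_submodule_image:
  assumes M: "left_module R M" and N: "left_module R N"
    and h: "h \<in> graded_hom R M MD N ND" and H: "graded_submodule R M MD H"
  shows "graded_submodule R N ND (h ` H)"
proof -
  interpret M: left_module R M by fact
  interpret N: left_module R N by fact
  interpret abelian_group_hom M N h by (rule graded_hom_abelian_group_hom[OF h M N])
  have sub: "submodule H R M" and gr: "graded_subgroup M MD H"
    using H unfolding graded_submodule_def by auto
  interpret H: submodule H R M by fact
  interpret H: additive_subgroup H M using sub by (rule submodule_additive_subgroup)
  have Hc: "x \<in> carrier M" if "x \<in> H" for x using that H.a_subset by blast
  have "submodule (h ` H) R N"
  proof (rule N.submoduleI)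
    show "h ` H \<subseteq> carrier N" using Hc by auto
    show "\<zero>\<^bsub>N\<^esub> \<in> h ` H" using hom_zero H.zero_closed by (metis imageI)
  next
    fix x y assume "x \<in> h ` H" "y \<in> h ` H"
    then obtain a b where "a \<in> H" "b \<in> H" "x = h a" "y = h b" by blast
    then show "x \<oplus>\<^bsub>N\<^esub> y \<in> h ` H" using Hc by (intro image_eqI[of _ _ "a \<oplus>\<^bsub>M\<^esub> b"]) auto
  next
    fix r x assume "r \<in> carrier R" "x \<in> h ` H"
    then obtain a where a: "a \<in> H" "x = h a" by blast
    show "r \<odot>\<^bsub>N\<^esub> x \<in> h ` H"
      using h Hc a \<open>r \<in> carrier R\<close>
      by (intro image_eqI[of _ _ "r \<odot>\<^bsub>M\<^esub> a"]) (auto simp: graded_hom_def)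
  qed
  moreover have "\<exists>f. homogeneous_decomposition N ND x f \<and> range f \<subseteq> h ` H" if "x \<in> h ` H" for x
  proof -
    obtain a where a: "a \<in> H" "x = h a" using \<open>x \<in> h ` H\<close> by blast
    obtain f where f: "homogeneous_decomposition M MD a f" "range f \<subseteq> H"
      using a gr unfolding graded_subgroup_def by blast
    have "homogeneous_decomposition N ND (h a) (\<lambda>n. h (f n))"
      using h Hc f(2) by (intro homogeneous_decomposition_image[OF abelian_group_hom_axioms f(1)])
        (auto simp: graded_hom_def)
    then show ?thesis using a f(2) by (intro exI[of _ "\<lambda>n. h (f n)"]) auto
  qed
  ultimately show ?thesis
    unfolding graded_submodule_def graded_subgroup_def by (simp add: submodule_additive_subgroup)
qed

text \<open>
  The first isomorphism theorem, for two homomorphisms with the same kernel: each image is the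
  quotient by that kernel. A preimage of an element of degree \<open>n\<close> can be chosen of degree \<open>n\<close>,
  which is why the isomorphism respects the gradings.
\<close>

lemma graded_iso_of_equal_kernels:
  assumes F: "graded_left_module R RD F FD" and M: "graded_left_module R RD M MD"
    and Q: "left_module R Q"
    and \<phi>: "\<phi> \<in> graded_hom R F FD M MD" "\<phi> ` carrier F = carrier M"
    and \<chi>: "\<chi> \<in> graded_hom R F FD Q QD"
    and ker: "\<And>u. u \<in> carrier F \<Longrightarrow> \<phi> u = \<zero>\<^bsub>M\<^esub> \<longleftrightarrow> \<chi> u = \<zero>\<^bsub>Q\<^esub>"
  shows "graded_iso R M MD (Q\<lparr>carrier := \<chi> ` carrier F\<rparr>) (\<lambda>n. QD n \<inter> \<chi> ` carrier F) \<noteq> {}"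
proof -
  note F' = graded_left_moduleD[OF F] and M' = graded_left_moduleD[OF M]
  interpret F: left_module R F by (rule F')
  interpret M: left_module R M by (rule M')
  interpret phi: abelian_group_hom F M \<phi> by (rule graded_hom_abelian_group_hom[OF \<phi>(1) F'(1) M'(1)])
  interpret chi: abelian_group_hom F Q \<chi> by (rule graded_hom_abelian_group_hom[OF \<chi> F'(1) Q])
  have eq: "\<phi> u = \<phi> v \<longleftrightarrow> \<chi> u = \<chi> v" if "u \<in> carrier F" "v \<in> carrier F" for u v
    using that ker[of "u \<ominus>\<^bsub>F\<^esub> v"] phi.eq_iff_kernel[OF that] chi.eq_iff_kernel[OF that] by simp
  define h where "h x = \<chi> (inv_into (carrier F) \<phi> x)" for x
  have h: "h (\<phi> u) = \<chi> u" if "u \<in> carrier F" for u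
    using that by (simp add: h_def eq[symmetric] inv_into_into f_inv_into_f)
  have rep: thesis if "x \<in> carrier M" "\<And>u. u \<in> carrier F \<Longrightarrow> x = \<phi> u \<Longrightarrow> thesis" for x thesis
    using that \<phi>(2) by blast
  have "inj_on h (carrier M)"
    unfolding \<phi>(2)[symmetric] by (auto intro!: inj_onI simp: h eq)
  moreover have "h ` carrier M = \<chi> ` carrier F"
    unfolding \<phi>(2)[symmetric] image_image using h by simp
  moreover have "h (x \<oplus>\<^bsub>M\<^esub> y) = h x \<oplus>\<^bsub>Q\<^esub> h y"
    if x: "x \<in> carrier M" and y: "y \<in> carrier M" for x y
  proof -
    obtain u where u: "u \<in> carrier F" "x = \<phi> u" using rep[OF x] .
    obtain v where v: "v \<in> carrier F" "y = \<phi> v" using rep[OF y] .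
    show ?thesis using h[of "u \<oplus>\<^bsub>F\<^esub> v"] u v by (simp add: h)
  qed
  moreover have "h (r \<odot>\<^bsub>M\<^esub> x) = r \<odot>\<^bsub>Q\<^esub> h x"
    if r: "r \<in> carrier R" and x: "x \<in> carrier M" for r x
  proof -
    obtain u where u: "u \<in> carrier F" "x = \<phi> u" using rep[OF x] .
    have "h (\<phi> (r \<odot>\<^bsub>F\<^esub> u)) = \<chi> (r \<odot>\<^bsub>F\<^esub> u)" by (rule h[OF F.smult_closed[OF r u(1)]])
    then show ?thesis
      using u \<phi>(1) \<chi> r by (simp add: h[OF u(1)] graded_hom_def)
  qed
  moreover have "h x \<in> QD n \<inter> \<chi> ` carrier F" if x: "x \<in> MD n" for x n
  proof -
    have xc: "x \<in> carrier M" using grading_closed[OF M'(2) x] .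
    obtain u where u: "u \<in> carrier F" "x = \<phi> u" using rep[OF xc] .
    obtain f where f: "homogeneous_decomposition F FD u f" and fc: "f \<in> UNIV \<rightarrow> carrier F"
      using homogeneous_decomposition_exists[OF F'(2) u(1)] .
    have "homogeneous_decomposition M MD x (\<lambda>k. \<phi> (f k))"
      unfolding u(2) using \<phi>(1)
      by (intro homogeneous_decomposition_image[OF phi.abelian_group_hom_axioms f fc])
        (auto simp: graded_hom_def)
    from homogeneous_decomposition_unique[OF M'(2) xc this homogeneous_decomposition_single[OF M'(3,2) x]]
    have "(\<lambda>k. \<phi> (f k)) = (\<lambda>k. if k = n then x else \<zero>\<^bsub>M\<^esub>)" .
    then have "x = \<phi> (f n)" by (auto dest: fun_cong[of _ _ n])
    moreover have "f n \<in> FD n" using f unfolding homogeneous_decomposition_def by simp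
    moreover have fn: "f n \<in> carrier F" using fc by auto
    ultimately show ?thesis using h[OF fn] \<chi> by (auto simp: graded_hom_def image_subset_iff)
  qed
  ultimately have "h \<in> graded_iso R M MD (Q\<lparr>carrier := \<chi> ` carrier F\<rparr>) (\<lambda>n. QD n \<inter> \<chi> ` carrier F)"
    unfolding graded_iso_def bij_betw_def by auto
  then show ?thesis by blast
qed


section \<open>Suspensions, coproducts and quotients\<close>

text \<open>
  A decomposition for the shifted grading is a decomposition for the original one with its degrees
  renumbered.
\<close>

lemma graded_left_module_suspension:
  assumes "graded_left_module R RD M MD"
  shows "graded_left_module R RD M (suspension d MD)"
proof -
  have shift: "homogeneous_decomposition M (suspension d MD) x f \<longleftrightarrow>
      homogeneous_decomposition M MD x (\<lambda>n. f (n + d))" for x f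
  proof -
    have eq: "{n. f n \<noteq> \<zero>\<^bsub>M\<^esub>} = (\<lambda>n. n + d) ` {n. f (n + d) \<noteq> \<zero>\<^bsub>M\<^esub>}"
    proof -
      have "n \<in> (\<lambda>n. n + d) ` {n. f (n + d) \<noteq> \<zero>\<^bsub>M\<^esub>}" if "f n \<noteq> \<zero>\<^bsub>M\<^esub>" for n
        using that by (intro image_eqI[of _ _ "n - d"]) auto
      then show ?thesis by auto
    qed
    have inj: "inj_on (\<lambda>n. n + d) A" for A by (auto intro: inj_onI)
    have deg: "(\<forall>n. f n \<in> MD (n - d)) \<longleftrightarrow> (\<forall>n. f (n + d) \<in> MD n)"
      by (metis add_diff_cancel_right' diff_add_cancel)
    have "finsum M f {n. f n \<noteq> \<zero>\<^bsub>M\<^esub>} = finsum M (\<lambda>n. f (n + d)) {n. f (n + d) \<noteq> \<zero>\<^bsub>M\<^esub>}"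
      if "\<forall>n. f n \<in> MD (n - d)"
    proof -
      interpret abelian_group M by (rule graded_left_moduleD(3)[OF assms])
      have "f n \<in> carrier M" for n
        using grading_closed[OF graded_left_moduleD(2)[OF assms]] that by metis
      then show ?thesis unfolding eq using inj by (intro add.finprod_reindex) auto
    qed
    moreover have "finite {n. f n \<noteq> \<zero>\<^bsub>M\<^esub>} \<longleftrightarrow> finite {n. f (n + d) \<noteq> \<zero>\<^bsub>M\<^esub>}"
      unfolding eq using finite_image_iff[OF inj] by blast
    ultimately show ?thesis
      unfolding homogeneous_decomposition_def suspension_def using deg by auto
  qed
  have "grading M (suspension d MD)"
    unfolding grading_def
  proof (intro conjI allI ballI)
    fix n show "additive_subgroup (suspension d MD n) M"
      using graded_left_moduleD(2)[OF assms] unfolding grading_def suspension_def by simp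
  next
    fix x assume x: "x \<in> carrier M"
    note gr = graded_left_moduleD(2)[OF assms]
    obtain f where f: "homogeneous_decomposition M MD x f"
      using homogeneous_decomposition_exists[OF gr x] .
    show "\<exists>!g. homogeneous_decomposition M (suspension d MD) x g"
      unfolding shift
    proof (rule ex1I[of _ "\<lambda>n. f (n - d)"])
      show "homogeneous_decomposition M MD x (\<lambda>n. f (n + d - d))" using f by simp
    next
      fix g assume "homogeneous_decomposition M MD x (\<lambda>n. g (n + d))"
      from homogeneous_decomposition_unique[OF gr x this f]
      have "g (n - d + d) = f (n - d)" for n by (rule fun_cong)
      then show "g = (\<lambda>n. f (n - d))" by auto
    qed
  qed
  moreover have "r \<odot>\<^bsub>M\<^esub> x \<in> MD (i + j - d)" if "r \<in> RD i" "x \<in> MD (j - d)" for r i x j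
  proof -
    have "r \<odot>\<^bsub>M\<^esub> x \<in> MD (i + (j - d))"
      using assms that unfolding graded_left_module_def by blast
    then show ?thesis by (simp add: algebra_simps)
  qed
  ultimately show ?thesis
    using assms unfolding graded_left_module_def suspension_def by simp
qed

lemma self_module_simps [simp]:
  "carrier (self_module R) = carrier R" "\<zero>\<^bsub>self_module R\<^esub> = \<zero>\<^bsub>R\<^esub>"
  "add (self_module R) = add R" "smult (self_module R) = monoid.mult R"
  by (simp_all add: self_module_def)

lemma left_module_self_module:
  assumes "ring R"
  shows "left_module R (self_module R)"
proof -
  interpret ring R by fact
  have "abelian_group (self_module R)"
  proof (rule abelian_groupI)
    fix x assume "x \<in> carrier (self_module R)"
    then show "\<exists>y\<in>carrier (self_module R). y \<oplus>\<^bsub>self_module R\<^esub> x = \<zero>\<^bsub>self_module R\<^esub>"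
      by (auto intro!: bexI[of _ "\<ominus>\<^bsub>R\<^esub> x"] simp: l_neg)
  qed (simp_all add: add.m_ac)
  then show ?thesis
    by (intro left_module.intro left_module_axioms.intro assms)
      (auto simp: l_distr r_distr m_assoc)
qed

lemma graded_left_module_self_module:
  assumes "graded_ring R RD"
  shows "graded_left_module R RD (self_module R) RD"
proof -
  have gr: "grading R RD" and R: "ring R" using assms unfolding graded_ring_def by auto
  interpret ring R by (rule R)
  interpret self: left_module R "self_module R" by (rule left_module_self_module[OF R])
  \<comment> \<open>The two additive groups differ in the type of the remaining record fields, so their sums and
    inverses have to be compared by way of the identity map.\<close>
  have id: "abelian_group_hom R (self_module R) (\<lambda>x. x)"
    by (rule additive_map_abelian_group_hom) (auto simp: abelian_group_axioms self.M.abelian_group_axioms)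
  have sub: "additive_subgroup (RD n) (self_module R)" for n
  proof -
    interpret additive_subgroup "RD n" R using gr unfolding grading_def by simp
    have "m_inv (add_monoid (self_module R)) x \<in> RD n" if "x \<in> RD n" for x
      unfolding a_inv_def[symmetric]
      using a_inv_closed[OF that] abelian_group_hom.hom_a_inv[OF id a_Hcarr[OF that]] by simp
    then show ?thesis
      using a_subset by (intro additive_subgroupI subgroup.intro) auto
  qed
  have "homogeneous_decomposition (self_module R) RD x f \<longleftrightarrow> homogeneous_decomposition R RD x f" for x f
  proof (cases "\<forall>n. f n \<in> RD n")
    case True
    then have "f n \<in> carrier R" for n using grading_closed[OF gr, of "f n" n] by simp
    then have "finsum R f A = finsum (self_module R) f A" for A using abelian_group_hom.hom_finsum[OF id, of f A] by simp
    then show ?thesis unfolding homogeneous_decomposition_def by simp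
  qed (auto simp: homogeneous_decomposition_def)
  then have "homogeneous_decomposition (self_module R) RD = homogeneous_decomposition R RD"
    by (intro ext)
  then have "grading (self_module R) RD"
    using gr sub unfolding grading_def by simp
  then show ?thesis
    using assms self.left_module_axioms unfolding graded_ring_def graded_left_module_def by simp
qed

lemma coproduct_carrier:
  "f \<in> carrier (coproduct_module I M) \<longleftrightarrow>
     f \<in> (\<Pi>\<^sub>E i\<in>I. carrier (M i)) \<and> finite {i \<in> I. f i \<noteq> \<zero>\<^bsub>M i\<^esub>}"
  by (simp add: coproduct_module_def)

lemma coproduct_simps [simp]:
  "\<zero>\<^bsub>coproduct_module I M\<^esub> = (\<lambda>i\<in>I. \<zero>\<^bsub>M i\<^esub>)"
  "f \<oplus>\<^bsub>coproduct_module I M\<^esub> g = (\<lambda>i\<in>I. f i \<oplus>\<^bsub>M i\<^esub> g i)"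
  "r \<odot>\<^bsub>coproduct_module I M\<^esub> f = (\<lambda>i\<in>I. r \<odot>\<^bsub>M i\<^esub> f i)"
  by (simp_all add: coproduct_module_def)

lemma left_module_coproduct:
  assumes R: "ring R" and M: "\<And>i. i \<in> I \<Longrightarrow> left_module R (M i)"
  shows "left_module R (coproduct_module I M)"
proof -
  let ?C = "coproduct_module I M"
  have ab: "abelian_group (M i)" if "i \<in> I" for i using M[OF that] by (simp add: left_module_def)
  note grp = abelian_groupE[OF ab]
  have zinv: "\<ominus>\<^bsub>M i\<^esub> \<zero>\<^bsub>M i\<^esub> = \<zero>\<^bsub>M i\<^esub>" if "i \<in> I" for i
    using abelian_group.minus_equality[OF ab[OF that]] grp(2)[OF that] grp(5)[OF that] by simp
  have val: "f i \<in> carrier (M i)" if "f \<in> carrier ?C" "i \<in> I" for f i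
    using that by (auto simp: coproduct_carrier)
  have ext: "(\<lambda>i\<in>I. f i) = f" if "f \<in> carrier ?C" for f
    using that by (auto simp: coproduct_carrier PiE_def extensional_restrict)
  have sub: "(\<lambda>i\<in>I. F i) \<in> carrier ?C"
    if "\<And>i. i \<in> I \<Longrightarrow> F i \<in> carrier (M i)" "finite {i \<in> I. f i \<noteq> \<zero>\<^bsub>M i\<^esub> \<or> g i \<noteq> \<zero>\<^bsub>M i\<^esub>}"
      "\<And>i. i \<in> I \<Longrightarrow> f i = \<zero>\<^bsub>M i\<^esub> \<Longrightarrow> g i = \<zero>\<^bsub>M i\<^esub> \<Longrightarrow> F i = \<zero>\<^bsub>M i\<^esub>" for F f g
  proof -
    have "{i \<in> I. (\<lambda>i\<in>I. F i) i \<noteq> \<zero>\<^bsub>M i\<^esub>} \<subseteq> {i \<in> I. f i \<noteq> \<zero>\<^bsub>M i\<^esub> \<or> g i \<noteq> \<zero>\<^bsub>M i\<^esub>}"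
      using that(3) by auto
    then show ?thesis
      using finite_subset[OF _ that(2)] that(1) by (simp add: coproduct_carrier)
  qed
  have fin: "finite {i \<in> I. f i \<noteq> \<zero>\<^bsub>M i\<^esub> \<or> g i \<noteq> \<zero>\<^bsub>M i\<^esub>}"
    if "f \<in> carrier ?C" "g \<in> carrier ?C" for f g
  proof -
    have "{i \<in> I. f i \<noteq> \<zero>\<^bsub>M i\<^esub> \<or> g i \<noteq> \<zero>\<^bsub>M i\<^esub>} = {i \<in> I. f i \<noteq> \<zero>\<^bsub>M i\<^esub>} \<union> {i \<in> I. g i \<noteq> \<zero>\<^bsub>M i\<^esub>}"
      by auto
    then show ?thesis using that by (simp add: coproduct_carrier)
  qed
  have "abelian_group ?C"
  proof (rule abelian_groupI)
    fix f g assume f: "f \<in> carrier ?C" and g: "g \<in> carrier ?C"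
    show "f \<oplus>\<^bsub>?C\<^esub> g \<in> carrier ?C"
      unfolding coproduct_simps
      by (rule sub[of _ f g]) (use grp fin f g val in auto)
    show "f \<oplus>\<^bsub>?C\<^esub> g = g \<oplus>\<^bsub>?C\<^esub> f"
      using f g val grp(4) by (auto simp: fun_eq_iff)
    fix h assume h: "h \<in> carrier ?C"
    show "f \<oplus>\<^bsub>?C\<^esub> g \<oplus>\<^bsub>?C\<^esub> h = f \<oplus>\<^bsub>?C\<^esub> (g \<oplus>\<^bsub>?C\<^esub> h)"
      using f g h val grp(3) by (auto simp: fun_eq_iff)
  next
    show "\<zero>\<^bsub>?C\<^esub> \<in> carrier ?C"
      using grp(2) by (simp add: coproduct_carrier)
  next
    fix f assume f: "f \<in> carrier ?C"
    show "\<zero>\<^bsub>?C\<^esub> \<oplus>\<^bsub>?C\<^esub> f = f"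
    proof -
      have "(\<lambda>i\<in>I. \<zero>\<^bsub>M i\<^esub> \<oplus>\<^bsub>M i\<^esub> f i) = (\<lambda>i\<in>I. f i)"
        using f val grp(5) by (auto simp: fun_eq_iff)
      then show ?thesis using ext[OF f] by (simp cong: restrict_cong)
    qed
    have "(\<lambda>i\<in>I. \<ominus>\<^bsub>M i\<^esub> f i) \<in> carrier ?C"
      by (rule sub[of _ f f])
        (use f val fin[OF f f] ab zinv in \<open>auto simp: abelian_group.a_inv_closed\<close>)
    then show "\<exists>g\<in>carrier ?C. g \<oplus>\<^bsub>?C\<^esub> f = \<zero>\<^bsub>?C\<^esub>"
      using f val ab by (intro bexI[of _ "\<lambda>i\<in>I. \<ominus>\<^bsub>M i\<^esub> f i"])
        (auto simp: fun_eq_iff abelian_group.l_neg)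
  qed
  then show ?thesis
  proof (intro left_module.intro left_module_axioms.intro R)
    fix a f assume a: "a \<in> carrier R" and f: "f \<in> carrier ?C"
    show "a \<odot>\<^bsub>?C\<^esub> f \<in> carrier ?C"
      unfolding coproduct_simps
      by (rule sub[of _ f f]) (use a f val fin[OF f f] M in \<open>auto simp: left_module.smult_closed[OF M] left_module.smult_r_null[OF M]\<close>)
    fix b assume b: "b \<in> carrier R"
    show "(a \<oplus>\<^bsub>R\<^esub> b) \<odot>\<^bsub>?C\<^esub> f = a \<odot>\<^bsub>?C\<^esub> f \<oplus>\<^bsub>?C\<^esub> b \<odot>\<^bsub>?C\<^esub> f"
      "(a \<otimes>\<^bsub>R\<^esub> b) \<odot>\<^bsub>?C\<^esub> f = a \<odot>\<^bsub>?C\<^esub> (b \<odot>\<^bsub>?C\<^esub> f)"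
      using a b f val
      by (auto simp: fun_eq_iff left_module.smult_l_distr[OF M] left_module.smult_assoc[OF M])
  next
    fix a f g assume "a \<in> carrier R" "f \<in> carrier ?C" "g \<in> carrier ?C"
    then show "a \<odot>\<^bsub>?C\<^esub> (f \<oplus>\<^bsub>?C\<^esub> g) = a \<odot>\<^bsub>?C\<^esub> f \<oplus>\<^bsub>?C\<^esub> a \<odot>\<^bsub>?C\<^esub> g"
      using val by (auto simp: fun_eq_iff left_module.smult_r_distr[OF M])
  next
    fix f assume f: "f \<in> carrier ?C"
    have "(\<lambda>i\<in>I. \<one>\<^bsub>R\<^esub> \<odot>\<^bsub>M i\<^esub> f i) = (\<lambda>i\<in>I. f i)"
      using f val by (auto simp: fun_eq_iff left_module.smult_one[OF M])
    then show "\<one>\<^bsub>R\<^esub> \<odot>\<^bsub>?C\<^esub> f = f" using ext[OF f] by simp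
  qed
qed

lemma coproduct_eval_hom:
  assumes R: "ring R" and M: "\<And>i. i \<in> I \<Longrightarrow> left_module R (M i)" and k: "k \<in> I"
  shows "abelian_group_hom (coproduct_module I M) (M k) (\<lambda>f. f k)"
proof -
  have "left_module R (coproduct_module I M)" by (rule left_module_coproduct[OF R M])
  then show ?thesis
    using M[OF k] k unfolding left_module_def
    by (intro additive_map_abelian_group_hom) (auto simp: coproduct_carrier)
qed

text \<open>
  Decompositions are formed coordinate by coordinate. Evaluation at a coordinate is additive and
  preserves degrees, which reduces uniqueness to the uniqueness in each summand.
\<close>

lemma graded_left_module_coproduct:
  assumes RD: "graded_ring R RD" and M: "\<And>i. i \<in> I \<Longrightarrow> graded_left_module R RD (M i) (MD i)"
  shows "graded_left_module R RD (coproduct_module I M) (coproduct_grading I M MD)"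
proof -
  let ?C = "coproduct_module I M" and ?CD = "coproduct_grading I M MD"
  have R: "ring R" and grR: "grading R RD" using RD unfolding graded_ring_def by auto
  have lm: "left_module R (M i)" and gr: "grading (M i) (MD i)" and ab: "abelian_group (M i)"
    if "i \<in> I" for i using graded_left_moduleD[OF M[OF that]] by simp_all
  have lC: "left_module R ?C" by (rule left_module_coproduct[OF R lm])
  interpret C: left_module R ?C by (rule lC)
  have eval: "abelian_group_hom ?C (M i) (\<lambda>f. f i)" if "i \<in> I" for i
    by (rule coproduct_eval_hom[where R = R]) (use R lm that in auto)
  have sub: "additive_subgroup (MD i n) (M i)" if "i \<in> I" for i n
    using gr[OF that] unfolding grading_def by simp
  have CDsub: "additive_subgroup (?CD n) ?C" for n
  proof -
    have "(\<ominus>\<^bsub>?C\<^esub> f) i = \<ominus>\<^bsub>M i\<^esub> f i" if "f \<in> carrier ?C" "i \<in> I" for f i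
      using abelian_group_hom.hom_a_inv[OF eval[OF that(2)] that(1)] .
    then have "\<ominus>\<^bsub>?C\<^esub> f \<in> ?CD n" if "f \<in> ?CD n" for f
      using that sub by (auto simp: coproduct_grading_def additive_subgroup.a_inv_closed)
    moreover have "f \<oplus>\<^bsub>?C\<^esub> g \<in> ?CD n" if "f \<in> ?CD n" "g \<in> ?CD n" for f g
      using that sub C.M.a_closed[of f g]
      by (auto simp: coproduct_grading_def additive_subgroup.a_closed)
    moreover have "\<zero>\<^bsub>?C\<^esub> \<in> ?CD n"
      using sub C.M.zero_closed by (auto simp: coproduct_grading_def additive_subgroup.zero_closed)
    moreover have "?CD n \<subseteq> carrier ?C" by (auto simp: coproduct_grading_def)
    ultimately show ?thesis
      by (intro additive_subgroupI subgroup.intro) (auto simp flip: a_inv_def simp del: coproduct_simps)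
  qed
  have evaldec: "homogeneous_decomposition (M i) (MD i) (f i) (\<lambda>n. g n i)"
    if g: "homogeneous_decomposition ?C ?CD f g" and i: "i \<in> I" for f g i
  proof -
    have "g n \<in> ?CD n" for n using g unfolding homogeneous_decomposition_def by simp
    then have "g \<in> UNIV \<rightarrow> carrier ?C" by (auto simp: coproduct_grading_def)
    from homogeneous_decomposition_image[OF eval[OF i] g this, of "MD i"] i
    show ?thesis by (auto simp: coproduct_grading_def)
  qed
  have "\<exists>!g. homogeneous_decomposition ?C ?CD f g" if f: "f \<in> carrier ?C" for f
  proof -
    have fi: "f i \<in> carrier (M i)" if "i \<in> I" for i using that f by (auto simp: coproduct_carrier)
    let ?S = "{i \<in> I. f i \<noteq> \<zero>\<^bsub>M i\<^esub>}"
    have S: "finite ?S" using f by (simp add: coproduct_carrier)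
    have "\<forall>i\<in>I. \<exists>h. homogeneous_decomposition (M i) (MD i) (f i) h"
      using homogeneous_decomposition_exists[OF gr fi] by metis
    then obtain F where F: "\<And>i. i \<in> I \<Longrightarrow> homogeneous_decomposition (M i) (MD i) (f i) (F i)"
      unfolding bchoice_iff by blast
    have FD: "F i n \<in> MD i n" if "i \<in> I" for i n
      using F[OF that] unfolding homogeneous_decomposition_def by simp
    have Fc: "F i n \<in> carrier (M i)" if "i \<in> I" for i n
      using grading_closed[OF gr[OF that] FD[OF that]] .
    have F0: "F i n = \<zero>\<^bsub>M i\<^esub>" if i: "i \<in> I" and "f i = \<zero>\<^bsub>M i\<^esub>" for i n
    proof -
      have "homogeneous_decomposition (M i) (MD i) (f i) (\<lambda>n. if n = 0 then \<zero>\<^bsub>M i\<^esub> else \<zero>\<^bsub>M i\<^esub>)"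
        unfolding that(2)
        by (rule homogeneous_decomposition_single[OF ab[OF i] gr[OF i] grading_zero[OF gr[OF i]]])
      from homogeneous_decomposition_unique[OF gr[OF i] fi[OF i] F[OF i] this]
      show ?thesis by simp
    qed
    define g where "g n = (\<lambda>i\<in>I. F i n)" for n
    have gC: "g n \<in> carrier ?C" for n
    proof -
      have "{i \<in> I. g n i \<noteq> \<zero>\<^bsub>M i\<^esub>} \<subseteq> ?S" using F0 by (auto simp: g_def)
      then show ?thesis using finite_subset[OF _ S] Fc by (simp add: coproduct_carrier g_def)
    qed
    have gD: "g n \<in> ?CD n" for n using gC FD by (simp add: coproduct_grading_def g_def)
    \<comment> \<open>Finitely many coordinates are nonzero, and each of them has finitely many components.\<close>
    let ?B = "\<Union>i\<in>?S. {n. F i n \<noteq> \<zero>\<^bsub>M i\<^esub>}"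
    have B: "finite ?B"
      using S F unfolding homogeneous_decomposition_def by (intro finite_UN_I) auto
    have gB: "{n. g n \<noteq> \<zero>\<^bsub>?C\<^esub>} \<subseteq> ?B"
    proof
      fix n assume n: "n \<in> {n. g n \<noteq> \<zero>\<^bsub>?C\<^esub>}"
      have "\<exists>i\<in>I. F i n \<noteq> \<zero>\<^bsub>M i\<^esub>"
      proof (rule ccontr)
        assume "\<not> ?thesis"
        then have "g n = \<zero>\<^bsub>?C\<^esub>" by (auto simp: g_def fun_eq_iff)
        with n show False by simp
      qed
      with F0 show "n \<in> ?B" by auto
    qed
    have "f = finsum ?C g ?B"
    proof (rule PiE_ext)
      show "f \<in> (\<Pi>\<^sub>E i\<in>I. carrier (M i))" using f by (simp add: coproduct_carrier)
      have "finsum ?C g ?B \<in> carrier ?C" using gC by (intro C.M.finsum_closed) auto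
      then show "finsum ?C g ?B \<in> (\<Pi>\<^sub>E i\<in>I. carrier (M i))" by (simp add: coproduct_carrier)
    next
      fix i assume i: "i \<in> I"
      interpret Mi: abelian_group "M i" by (rule ab[OF i])
      have "finsum ?C g ?B i = (\<Oplus>\<^bsub>M i\<^esub>n\<in>?B. g n i)"
        using abelian_group_hom.hom_finsum[OF eval[OF i], of g ?B] gC by simp
      also have "\<dots> = finsum (M i) (F i) ?B"
        using i Fc by (intro Mi.add.finprod_cong') (auto simp: g_def)
      also have "\<dots> = f i"
      proof -
        have "{n. F i n \<noteq> \<zero>\<^bsub>M i\<^esub>} \<subseteq> ?B" using i F0 by auto
        from homogeneous_decomposition_superset[OF ab[OF i] _ B this] F[OF i] Fc[OF i]
        show ?thesis by auto
      qed
      finally show "f i = finsum ?C g ?B i" by simp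
    qed
    then have g: "homogeneous_decomposition ?C ?CD f g"
      using homogeneous_decomposition_superset[OF C.M.abelian_group_axioms _ B gB] gC gD by auto
    show ?thesis
    proof (rule ex1I[of _ g])
      show "homogeneous_decomposition ?C ?CD f g" by (rule g)
    next
      fix g' assume g': "homogeneous_decomposition ?C ?CD f g'"
      have "g' n = g n" for n
      proof (rule PiE_ext)
        have "g' n \<in> ?CD n" using g' unfolding homogeneous_decomposition_def by simp
        then show "g' n \<in> (\<Pi>\<^sub>E i\<in>I. carrier (M i))"
          by (simp add: coproduct_grading_def coproduct_carrier)
        show "g n \<in> (\<Pi>\<^sub>E i\<in>I. carrier (M i))" using gC by (simp add: coproduct_carrier)
      next
        fix i assume i: "i \<in> I"
        from homogeneous_decomposition_unique[OF gr[OF i] fi[OF i] evaldec[OF g' i] F[OF i]]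
        have "g' n i = F i n" by (rule fun_cong)
        then show "g' n i = g n i" using i by (simp add: g_def)
      qed
      then show "g' = g" by (rule ext)
    qed
  qed
  then have "grading ?C ?CD" unfolding grading_def using CDsub by simp
  moreover have "r \<odot>\<^bsub>?C\<^esub> f \<in> ?CD (i + j)" if r: "r \<in> RD i" and f: "f \<in> ?CD j" for r f i j
  proof -
    have "r \<in> carrier R" "f \<in> carrier ?C"
      using grading_closed[OF grR r] f by (simp_all add: coproduct_grading_def)
    then have "r \<odot>\<^bsub>?C\<^esub> f \<in> carrier ?C" by (rule C.smult_closed)
    moreover have "r \<odot>\<^bsub>M k\<^esub> f k \<in> MD k (i + j)" if "k \<in> I" for k
      using M[OF that] r f that unfolding graded_left_module_def by (simp add: coproduct_grading_def)
    ultimately show ?thesis by (simp add: coproduct_grading_def)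
  qed
  ultimately show ?thesis
    unfolding graded_left_module_def using lC by simp
qed

text \<open>
  Scalar multiplication on the quotient is defined by a union over representatives; all of them
  give the same coset because \<open>L\<close> is a submodule.
\<close>

lemma quotient_projection:
  assumes C: "left_module R C" and L: "submodule L R C"
  shows "left_module R (quotient_module C L)"
    and "(\<lambda>c. L +>\<^bsub>C\<^esub> c) \<in> graded_hom R C CD (quotient_module C L) (quotient_grading C CD L)"
    and "\<And>c. c \<in> carrier C \<Longrightarrow> L +>\<^bsub>C\<^esub> c = L \<longleftrightarrow> c \<in> L"
proof -
  let ?Q = "quotient_module C L"
  interpret C: left_module R C by fact
  interpret L: submodule L R C by fact
  interpret A: abelian_subgroup L C
    by (rule abelian_subgroupI3[OF submodule_additive_subgroup[OF L] C.M.abelian_group_axioms])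
  have surj: "(\<lambda>c. L +>\<^bsub>C\<^esub> c) ` carrier C = carrier ?Q"
    by (auto simp: quotient_module_def A_RCOSETS_def')
  have add: "L +>\<^bsub>C\<^esub> (x \<oplus>\<^bsub>C\<^esub> y) = (L +>\<^bsub>C\<^esub> x) \<oplus>\<^bsub>?Q\<^esub> (L +>\<^bsub>C\<^esub> y)"
    if "x \<in> carrier C" "y \<in> carrier C" for x y
    using A.a_rcos_sum[OF that] by (simp add: quotient_module_def)
  have zero: "L +>\<^bsub>C\<^esub> \<zero>\<^bsub>C\<^esub> = \<zero>\<^bsub>?Q\<^esub>"
    using C.M.a_coset_add_zero[OF A.a_subset] by (simp add: quotient_module_def)
  have smult: "L +>\<^bsub>C\<^esub> (r \<odot>\<^bsub>C\<^esub> x) = r \<odot>\<^bsub>?Q\<^esub> (L +>\<^bsub>C\<^esub> x)"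
    if r: "r \<in> carrier R" and x: "x \<in> carrier C" for r x
  proof -
    have "L +>\<^bsub>C\<^esub> (r \<odot>\<^bsub>C\<^esub> y) = L +>\<^bsub>C\<^esub> (r \<odot>\<^bsub>C\<^esub> x)" if "y \<in> L +>\<^bsub>C\<^esub> x" for y
    proof -
      obtain l where l: "l \<in> L" "y = l \<oplus>\<^bsub>C\<^esub> x" using \<open>y \<in> L +>\<^bsub>C\<^esub> x\<close> by (auto simp: a_r_coset_def')
      have lc: "l \<in> carrier C" "r \<odot>\<^bsub>C\<^esub> l \<in> carrier C" "r \<odot>\<^bsub>C\<^esub> l \<in> L"
        using l(1) A.a_subset L.smult_closed[OF r l(1)] by auto
      have "L +>\<^bsub>C\<^esub> (r \<odot>\<^bsub>C\<^esub> y) = (L +>\<^bsub>C\<^esub> (r \<odot>\<^bsub>C\<^esub> l)) +>\<^bsub>C\<^esub> (r \<odot>\<^bsub>C\<^esub> x)"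
        using lc r x l A.a_subset by (simp add: C.M.a_coset_add_assoc C.smult_r_distr)
      also have "L +>\<^bsub>C\<^esub> (r \<odot>\<^bsub>C\<^esub> l) = L"
        using C.M.a_coset_join2[OF lc(2) A.a_subgroup lc(3)] .
      finally show ?thesis .
    qed
    then have "(\<Union>y\<in>L +>\<^bsub>C\<^esub> x. L +>\<^bsub>C\<^esub> (r \<odot>\<^bsub>C\<^esub> y)) = (\<Union>y\<in>L +>\<^bsub>C\<^esub> x. L +>\<^bsub>C\<^esub> (r \<odot>\<^bsub>C\<^esub> x))"
      by (intro SUP_cong refl)
    also have "\<dots> = L +>\<^bsub>C\<^esub> (r \<odot>\<^bsub>C\<^esub> x)" using A.a_rcos_self[OF x] by (intro SUP_const) blast
    finally show ?thesis by (simp add: quotient_module_def)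
  qed
  show "left_module R ?Q"
    by (rule left_module_surjective_image[OF C surj]) (fact add zero smult)+
  show "(\<lambda>c. L +>\<^bsub>C\<^esub> c) \<in> graded_hom R C CD ?Q (quotient_grading C CD L)"
  proof -
    have "L +>\<^bsub>C\<^esub> c \<in> carrier ?Q" if "c \<in> carrier C" for c
      unfolding surj[symmetric] using that by (rule imageI)
    then show ?thesis
      unfolding graded_hom_def quotient_grading_def by (simp add: add smult)
  qed
  show "L +>\<^bsub>C\<^esub> c = L \<longleftrightarrow> c \<in> L" if "c \<in> carrier C" for c
    by (rule iffI[OF C.M.a_coset_join1[OF _ that A.a_subgroup] C.M.a_coset_join2[OF that A.a_subgroup]])
qed

definition coproduct_map ::
    "('a, 'n, 'e) module_scheme \<Rightarrow> 'i set \<Rightarrow> ('i \<Rightarrow> ('a, 'm, 'd) module_scheme) \<Rightarrow>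
     ('i \<Rightarrow> 'm \<Rightarrow> 'n) \<Rightarrow> ('i \<Rightarrow> 'm) \<Rightarrow> 'n" where
  "coproduct_map N I Y h f = finsum N (\<lambda>i. h i (f i)) {i \<in> I. f i \<noteq> \<zero>\<^bsub>Y i\<^esub>}"

lemma coproduct_map_superset:
  assumes "abelian_group N" and h: "\<And>i. i \<in> I \<Longrightarrow> abelian_group_hom (Y i) N (h i)"
    and f: "f \<in> carrier (coproduct_module I Y)"
    and A: "finite A" "A \<subseteq> I" "{i \<in> I. f i \<noteq> \<zero>\<^bsub>Y i\<^esub>} \<subseteq> A"
  shows "coproduct_map N I Y h f = (\<Oplus>\<^bsub>N\<^esub>i\<in>A. h i (f i))"
proof -
  interpret N: abelian_group N by fact
  have fi: "f i \<in> carrier (Y i)" if "i \<in> I" for i using f that by (auto simp: coproduct_carrier)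
  have "h i (f i) \<in> carrier N" if "i \<in> I" for i
    using abelian_group_hom.hom_closed[OF h[OF that] fi[OF that]] .
  moreover have "h i (f i) = \<zero>\<^bsub>N\<^esub>" if "i \<in> I" "f i = \<zero>\<^bsub>Y i\<^esub>" for i
    using abelian_group_hom.hom_zero[OF h[OF that(1)]] that(2) by simp
  ultimately show ?thesis
    unfolding coproduct_map_def using A by (intro N.add.finprod_mono_neutral_cong_left) auto
qed

lemma graded_hom_coproduct_map:
  assumes RD: "graded_ring R RD" and N: "graded_left_module R RD N ND"
    and Y: "\<And>i. i \<in> I \<Longrightarrow> graded_left_module R RD (Y i) (YD i)"
    and h: "\<And>i. i \<in> I \<Longrightarrow> h i \<in> graded_hom R (Y i) (YD i) N ND"
  shows "coproduct_map N I Y h \<in>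
    graded_hom R (coproduct_module I Y) (coproduct_grading I Y YD) N ND"
proof -
  let ?C = "coproduct_module I Y" and ?p = "coproduct_map N I Y h"
  interpret N: left_module R N by (rule graded_left_moduleD(1)[OF N])
  have "left_module R (Y i)" if "i \<in> I" for i using graded_left_moduleD(1)[OF Y[OF that]] .
  then have hom: "abelian_group_hom (Y i) N (h i)" if "i \<in> I" for i
    using graded_hom_abelian_group_hom[OF h[OF that] _ N.left_module_axioms] that by simp
  have lC: "left_module R ?C"
    by (rule graded_left_moduleD(1)[OF graded_left_module_coproduct[OF RD Y]])
  then interpret C: left_module R ?C .
  let ?S = "\<lambda>f. {i \<in> I. f i \<noteq> \<zero>\<^bsub>Y i\<^esub>}"
  have S: "finite (?S f)" and fi: "\<And>i. i \<in> I \<Longrightarrow> f i \<in> carrier (Y i)"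
    if "f \<in> carrier ?C" for f using that by (auto simp: coproduct_carrier)
  have hf: "h i (f i) \<in> carrier N" if "f \<in> carrier ?C" "i \<in> I" for f i
    using abelian_group_hom.hom_closed[OF hom[OF that(2)] fi[OF that]] .
  note sup = coproduct_map_superset[OF N.M.abelian_group_axioms hom]
  have "?p f \<in> carrier N" if f: "f \<in> carrier ?C" for f
    unfolding coproduct_map_def using hf[OF f] by (intro N.M.finsum_closed) auto
  moreover have "?p (f \<oplus>\<^bsub>?C\<^esub> g) = ?p f \<oplus>\<^bsub>N\<^esub> ?p g" if f: "f \<in> carrier ?C" and g: "g \<in> carrier ?C" for f g
  proof -
    let ?A = "?S f \<union> ?S g \<union> ?S (f \<oplus>\<^bsub>?C\<^esub> g)"
    have A: "finite ?A" using S[OF f] S[OF g] S[OF C.M.a_closed[OF f g]] by simp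
    have "?p (f \<oplus>\<^bsub>?C\<^esub> g) = (\<Oplus>\<^bsub>N\<^esub>i\<in>?A. h i ((f \<oplus>\<^bsub>?C\<^esub> g) i))"
      by (rule sup[OF _ C.M.a_closed[OF f g] A]) auto
    also have "\<dots> = (\<Oplus>\<^bsub>N\<^esub>i\<in>?A. h i (f i) \<oplus>\<^bsub>N\<^esub> h i (g i))"
      using hf[OF f] hf[OF g] fi[OF f] fi[OF g] abelian_group_hom.hom_add[OF hom]
      by (intro N.M.add.finprod_cong') auto
    also have "\<dots> = (\<Oplus>\<^bsub>N\<^esub>i\<in>?A. h i (f i)) \<oplus>\<^bsub>N\<^esub> (\<Oplus>\<^bsub>N\<^esub>i\<in>?A. h i (g i))"
      using hf[OF f] hf[OF g] by (intro N.M.finsum_addf) auto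
    also have "(\<Oplus>\<^bsub>N\<^esub>i\<in>?A. h i (f i)) = ?p f" by (rule sup[OF _ f A, symmetric]) auto
    also have "(\<Oplus>\<^bsub>N\<^esub>i\<in>?A. h i (g i)) = ?p g" by (rule sup[OF _ g A, symmetric]) auto
    finally show ?thesis .
  qed
  moreover have "?p (r \<odot>\<^bsub>?C\<^esub> f) = r \<odot>\<^bsub>N\<^esub> ?p f" if r: "r \<in> carrier R" and f: "f \<in> carrier ?C" for r f
  proof -
    let ?A = "?S f \<union> ?S (r \<odot>\<^bsub>?C\<^esub> f)"
    have A: "finite ?A" using S[OF f] S[OF C.smult_closed[OF r f]] by simp
    have "?p (r \<odot>\<^bsub>?C\<^esub> f) = (\<Oplus>\<^bsub>N\<^esub>i\<in>?A. h i ((r \<odot>\<^bsub>?C\<^esub> f) i))"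
      by (rule sup[OF _ C.smult_closed[OF r f] A]) auto
    also have "\<dots> = (\<Oplus>\<^bsub>N\<^esub>i\<in>?A. r \<odot>\<^bsub>N\<^esub> h i (f i))"
    proof (rule N.M.add.finprod_cong')
      show "(\<lambda>i. r \<odot>\<^bsub>N\<^esub> h i (f i)) \<in> ?A \<rightarrow> carrier N" using hf[OF f] r by auto
      fix i assume "i \<in> ?A"
      then have "i \<in> I" by auto
      then show "h i ((r \<odot>\<^bsub>?C\<^esub> f) i) = r \<odot>\<^bsub>N\<^esub> h i (f i)"
        using h[OF \<open>i \<in> I\<close>] r fi[OF f \<open>i \<in> I\<close>] by (simp add: graded_hom_def)
    qed simp
    also have "\<dots> = r \<odot>\<^bsub>N\<^esub> (\<Oplus>\<^bsub>N\<^esub>i\<in>?A. h i (f i))"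
      using abelian_group_hom.hom_finsum[OF N.smult_r_hom[OF r], of "\<lambda>i. h i (f i)" ?A] hf[OF f] by auto
    also have "(\<Oplus>\<^bsub>N\<^esub>i\<in>?A. h i (f i)) = ?p f" by (rule sup[OF _ f A, symmetric]) auto
    finally show ?thesis .
  qed
  moreover have "?p f \<in> ND n" if f: "f \<in> coproduct_grading I Y YD n" for f n
    unfolding coproduct_map_def
  proof (rule additive_subgroup_finsum_closed[OF N.M.abelian_group_axioms])
    show "additive_subgroup (ND n) N" using graded_left_moduleD(2)[OF N] unfolding grading_def by simp
  next
    fix i assume i: "i \<in> ?S f"
    then have "f i \<in> YD i n" using f by (simp add: coproduct_grading_def)
    then show "h i (f i) \<in> ND n" using h[of i] i by (auto simp: graded_hom_def image_subset_iff)
  qed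
  ultimately show ?thesis unfolding graded_hom_def by (simp add: Pi_iff image_subset_iff)
qed


section \<open>Annihilators and distinguished ideals\<close>

lemma graded_hom_orbit_map:
  assumes M: "graded_left_module R RD M MD" and m: "m \<in> MD n"
  shows "(\<lambda>r. r \<odot>\<^bsub>M\<^esub> m) \<in> graded_hom R (self_module R) (suspension n RD) M MD"
proof -
  interpret M: left_module R M by (rule graded_left_moduleD(1)[OF M])
  have mc: "m \<in> carrier M" by (rule grading_closed[OF graded_left_moduleD(2)[OF M] m])
  have "r \<odot>\<^bsub>M\<^esub> m \<in> MD k" if "r \<in> RD (k - n)" for r k
  proof -
    have "r \<odot>\<^bsub>M\<^esub> m \<in> MD (k - n + n)"
      using M m that unfolding graded_left_module_def by blast
    then show ?thesis by simp
  qed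
  then show ?thesis
    using mc by (auto simp: graded_hom_def suspension_def M.smult_l_distr M.smult_assoc)
qed

text \<open>The annihilator of \<open>m\<close> is the kernel of the orbit map \<open>r \<mapsto> r m\<close>.\<close>

lemma homogeneous_left_ideal_left_ann:
  assumes RD: "graded_ring R RD" and M: "graded_left_module R RD M MD" and m: "homogeneous MD m"
  shows "homogeneous_left_ideal R RD (left_ann R M m)"
proof -
  obtain n where n: "m \<in> MD n" using m unfolding homogeneous_def by blast
  \<comment> \<open>After a shift that puts \<open>m\<close> in degree \<open>0\<close>, the map \<open>r \<mapsto> r m\<close> preserves degrees.\<close>
  have m0: "m \<in> suspension (- n) MD 0" using n by (simp add: suspension_def)
  note MS = graded_left_module_suspension[OF M, of "- n"]
  have "suspension 0 RD = RD" by (simp add: suspension_def)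
  with graded_hom_orbit_map[OF MS m0]
  have "(\<lambda>r. r \<odot>\<^bsub>M\<^esub> m) \<in> graded_hom R (self_module R) RD M (suspension (- n) MD)" by simp
  from graded_submodule_kernel[OF graded_left_module_self_module[OF RD] MS this]
  show ?thesis unfolding homogeneous_left_ideal_def left_ann_def by simp
qed

definition common_ann :: "('a, 'c) ring_scheme \<Rightarrow> ('a, 'm, 'd) module_scheme \<Rightarrow> 'm set \<Rightarrow> 'a set" where
  "common_ann R M S = {r \<in> carrier R. \<forall>m\<in>S. r \<odot>\<^bsub>M\<^esub> m = \<zero>\<^bsub>M\<^esub>}"

text \<open>
  The annihilator of a homogeneous element is always a homogeneous left ideal, and an element \<open>0\<close> of
  \<open>S\<close> only contributes the ideal \<open>R\<close>, which does not change the intersection. Admitting \<open>0\<close> makes it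
  possible to multiply \<open>S\<close> by scalars.
\<close>

lemma dist_bar_iff:
  assumes RD: "graded_ring R RD" and \<Theta>: "graded_left_module R RD \<Theta> \<Theta>D"
  shows "I \<in> dist_bar R RD \<Theta> \<Theta>D \<longleftrightarrow>
    (\<exists>S. finite S \<and> (\<forall>\<theta>\<in>S. homogeneous \<Theta>D \<theta>) \<and> I = common_ann R \<Theta> S)" (is "?L \<longleftrightarrow> ?R")
proof
  assume ?L
  then obtain F where F: "finite F" "\<forall>J\<in>F. strongly_distinguished R RD \<Theta> \<Theta>D J" "I = carrier R \<inter> \<Inter>F"
    unfolding dist_bar_def by blast
  have "\<forall>J\<in>F. \<exists>\<theta>. homogeneous \<Theta>D \<theta> \<and> left_ann R \<Theta> \<theta> = J"
    using F(2) unfolding strongly_distinguished_def by auto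
  then obtain t where t: "\<forall>J\<in>F. homogeneous \<Theta>D (t J) \<and> left_ann R \<Theta> (t J) = J"
    unfolding bchoice_iff by blast
  have ann: "r \<in> J \<longleftrightarrow> r \<in> carrier R \<and> r \<odot>\<^bsub>\<Theta>\<^esub> t J = \<zero>\<^bsub>\<Theta>\<^esub>" if "J \<in> F" for r J
  proof -
    have "r \<in> J \<longleftrightarrow> r \<in> left_ann R \<Theta> (t J)" using t that by simp
    then show ?thesis by (simp add: left_ann_def)
  qed
  have "I = common_ann R \<Theta> (t ` F)"
    unfolding F(3) common_ann_def using ann by auto
  moreover have "finite (t ` F)" "\<forall>\<theta>\<in>t ` F. homogeneous \<Theta>D \<theta>" using F(1) t by auto
  ultimately show ?R by (intro exI[of _ "t ` F"]) simp
next
  assume ?R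
  then obtain S where S: "finite S" "\<forall>\<theta>\<in>S. homogeneous \<Theta>D \<theta>" "I = common_ann R \<Theta> S" by blast
  interpret \<Theta>: left_module R \<Theta> by (rule graded_left_moduleD(1)[OF \<Theta>])
  let ?F = "left_ann R \<Theta> ` (S - {\<zero>\<^bsub>\<Theta>\<^esub>})"
  have "\<forall>J\<in>?F. strongly_distinguished R RD \<Theta> \<Theta>D J"
  proof
    fix J assume "J \<in> ?F"
    then obtain \<theta> where \<theta>: "\<theta> \<in> S" "\<theta> \<noteq> \<zero>\<^bsub>\<Theta>\<^esub>" "J = left_ann R \<Theta> \<theta>" by auto
    have "homogeneous \<Theta>D \<theta>" using S(2) \<theta>(1) by simp
    with \<theta> homogeneous_left_ideal_left_ann[OF RD \<Theta> this]
    show "strongly_distinguished R RD \<Theta> \<Theta>D J"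
      unfolding strongly_distinguished_def by (intro conjI exI[of _ \<theta>]) simp_all
  qed
  moreover have "finite ?F" using S(1) by simp
  moreover have "I = carrier R \<inter> \<Inter>?F"
  proof -
    have "r \<odot>\<^bsub>\<Theta>\<^esub> \<theta> = \<zero>\<^bsub>\<Theta>\<^esub>" if "r \<in> carrier R" "\<theta> = \<zero>\<^bsub>\<Theta>\<^esub>" for r \<theta>
      using \<Theta>.smult_r_null that by simp
    then show ?thesis unfolding S(3) common_ann_def left_ann_def by auto
  qed
  ultimately show ?L
    unfolding dist_bar_def by (intro CollectI exI[of _ ?F] conjI)
qed

lemma distinguished_left_ann_iff:
  assumes RD: "graded_ring R RD" and \<Theta>: "graded_left_module R RD \<Theta> \<Theta>D"
    and M: "graded_left_module R RD M MD" and m: "homogeneous MD m"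
  shows "distinguished R RD \<Theta> \<Theta>D (left_ann R M m) \<longleftrightarrow>
    (\<exists>S. finite S \<and> (\<forall>\<theta>\<in>S. homogeneous \<Theta>D \<theta>) \<and> common_ann R \<Theta> S \<subseteq> left_ann R M m)"
  unfolding distinguished_def Bex_def dist_bar_iff[OF RD \<Theta>]
  using homogeneous_left_ideal_left_ann[OF RD M m] by (simp only: simp_thms) metis


section \<open>Rational modules\<close>

text \<open>
  A homogeneous element of \<open>M\<close> comes from a homogeneous family of elements of \<open>\<Theta>\<close> with finite
  support, and the finitely many nonzero entries of that family control its annihilator.
\<close>

lemma rational_imp_distinguished:
  assumes RD: "graded_ring R RD" and \<Theta>: "graded_left_module R RD \<Theta> \<Theta>D"
    and M: "graded_left_module R RD M MD"
    and rat: "rational TYPE('i) R \<Theta> \<Theta>D M MD" and m: "homogeneous MD m"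
  shows "distinguished R RD \<Theta> \<Theta>D (left_ann R M m)"
proof -
  obtain I :: "'i set" and d L K h where
    L: "graded_submodule R (coproduct_module I (\<lambda>i. \<Theta>))
      (coproduct_grading I (\<lambda>i. \<Theta>) (\<lambda>i. suspension (d i) \<Theta>D)) L" and
    K: "graded_submodule R (quotient_module (coproduct_module I (\<lambda>i. \<Theta>)) L)
      (quotient_grading (coproduct_module I (\<lambda>i. \<Theta>))
        (coproduct_grading I (\<lambda>i. \<Theta>) (\<lambda>i. suspension (d i) \<Theta>D)) L) K" and
    h: "h \<in> graded_iso R M MD ((quotient_module (coproduct_module I (\<lambda>i. \<Theta>)) L)\<lparr>carrier := K\<rparr>)
      (\<lambda>n. quotient_grading (coproduct_module I (\<lambda>i. \<Theta>))
        (coproduct_grading I (\<lambda>i. \<Theta>) (\<lambda>i. suspension (d i) \<Theta>D)) L n \<inter> K)"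
    using rat unfolding rational_def Let_def by auto
  define C where "C = coproduct_module I (\<lambda>i. \<Theta>)"
  define CD where "CD = coproduct_grading I (\<lambda>i. \<Theta>) (\<lambda>i. suspension (d i) \<Theta>D)"
  define Q where "Q = quotient_module C L"
  note C_def [symmetric, simp] CD_def [symmetric, simp] Q_def [symmetric, simp]
  have \<Theta>S: "graded_left_module R RD \<Theta> (suspension (d i) \<Theta>D)" for i
    by (rule graded_left_module_suspension[OF \<Theta>])
  have "graded_left_module R RD C CD"
    unfolding C_def CD_def by (rule graded_left_module_coproduct[OF RD \<Theta>S])
  then interpret C: left_module R C by (rule graded_left_moduleD)
  interpret M: left_module R M by (rule graded_left_moduleD(1)[OF M])
  have sL: "submodule L R C" using L unfolding graded_submodule_def by simp
  note proj = quotient_projection[OF C.left_module_axioms sL, folded Q_def]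
  interpret Q: left_module R Q by (rule proj(1))
  have sK: "submodule K R Q" using K unfolding graded_submodule_def by simp
  have KQ: "x \<in> carrier Q" if "x \<in> K" for x
    using additive_subgroup.a_subset[OF submodule_additive_subgroup[OF sK]] that by auto
  have bij: "bij_betw h (carrier M) K"
    and hadd: "\<And>x y. x \<in> carrier M \<Longrightarrow> y \<in> carrier M \<Longrightarrow> h (x \<oplus>\<^bsub>M\<^esub> y) = h x \<oplus>\<^bsub>Q\<^esub> h y"
    and hsmult: "\<And>r x. r \<in> carrier R \<Longrightarrow> x \<in> carrier M \<Longrightarrow> h (r \<odot>\<^bsub>M\<^esub> x) = r \<odot>\<^bsub>Q\<^esub> h x"
    and hdeg: "\<And>x n. x \<in> MD n \<Longrightarrow> h x \<in> quotient_grading C CD L n"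
    using h by (auto simp: graded_iso_def image_subset_iff)
  have hQ: "h x \<in> carrier Q" if "x \<in> carrier M" for x
    using KQ bij_betwE[OF bij] that by simp
  interpret h: abelian_group_hom M Q h
    by (rule additive_map_abelian_group_hom) (simp_all add: M.M.abelian_group_axioms Q.M.abelian_group_axioms hadd hQ)
  obtain n where n: "m \<in> MD n" using m unfolding homogeneous_def by blast
  have mc: "m \<in> carrier M" by (rule grading_closed[OF graded_left_moduleD(2)[OF M] n])
  obtain f where f: "f \<in> CD n" "h m = L +>\<^bsub>C\<^esub> f"
    using hdeg[OF n] unfolding quotient_grading_def by auto
  have fC: "f \<in> carrier C" and fi: "\<And>i. i \<in> I \<Longrightarrow> f i \<in> \<Theta>D (n - d i)"
    using f(1) unfolding CD_def C_def coproduct_grading_def suspension_def by auto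
  let ?S = "f ` {i \<in> I. f i \<noteq> \<zero>\<^bsub>\<Theta>\<^esub>}"
  have "finite ?S" using fC unfolding C_def coproduct_carrier by simp
  moreover have "\<forall>\<theta>\<in>?S. homogeneous \<Theta>D \<theta>" using fi unfolding homogeneous_def by auto
  moreover have "r \<in> left_ann R M m" if r: "r \<in> common_ann R \<Theta> ?S" for r
  proof -
    interpret \<Theta>: left_module R \<Theta> by (rule graded_left_moduleD(1)[OF \<Theta>])
    have rR: "r \<in> carrier R" using r unfolding common_ann_def by simp
    have "r \<odot>\<^bsub>\<Theta>\<^esub> f i = \<zero>\<^bsub>\<Theta>\<^esub>" if "i \<in> I" for i
      using r that \<Theta>.smult_r_null[OF rR] unfolding common_ann_def by (cases "f i = \<zero>\<^bsub>\<Theta>\<^esub>") auto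
    then have rf: "r \<odot>\<^bsub>C\<^esub> f = \<zero>\<^bsub>C\<^esub>"
      unfolding C_def coproduct_simps by (intro restrict_ext)
    have "h (r \<odot>\<^bsub>M\<^esub> m) = r \<odot>\<^bsub>Q\<^esub> (L +>\<^bsub>C\<^esub> f)" using hsmult[OF rR mc] f(2) by simp
    also have "\<dots> = L +>\<^bsub>C\<^esub> (r \<odot>\<^bsub>C\<^esub> f)"
      using proj(2) rR fC unfolding graded_hom_def by simp
    also have "\<dots> = h \<zero>\<^bsub>M\<^esub>"
    proof -
      have "L +>\<^bsub>C\<^esub> \<zero>\<^bsub>C\<^esub> = \<zero>\<^bsub>Q\<^esub>"
        using abelian_group_hom.hom_zero[OF graded_hom_abelian_group_hom[OF proj(2)
            C.left_module_axioms Q.left_module_axioms]] .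
      then show ?thesis using rf h.hom_zero by simp
    qed
    finally have "r \<odot>\<^bsub>M\<^esub> m = \<zero>\<^bsub>M\<^esub>"
      using inj_onD[OF bij_betw_imp_inj_on[OF bij]] M.smult_closed[OF rR mc] M.M.zero_closed by simp
    then show ?thesis using rR unfolding left_ann_def by simp
  qed
  ultimately show ?thesis
    unfolding distinguished_left_ann_iff[OF RD \<Theta> M m]
    by (intro exI[of _ ?S]) (simp add: subset_iff)
qed

text \<open>
  \<open>M\<close> is presented by generators, its homogeneous elements, and relations. The same generators are
  realised in a coproduct of suspensions of \<open>\<Theta>\<close>, where they satisfy no relation that fails in \<open>M\<close>;
  the missing relations are then imposed by passing to a quotient.
\<close>

lemma distinguished_imp_rational:
  fixes M :: "('a, 'm, 'd) module_scheme" and MD :: "int \<Rightarrow> 'm set"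
    and \<Theta> :: "('a, 't, 'e) module_scheme"
  assumes RD: "graded_ring R RD" and \<Theta>: "graded_left_module R RD \<Theta> \<Theta>D"
    and M: "graded_left_module R RD M MD"
    and dist: "\<And>m. homogeneous MD m \<Longrightarrow> distinguished R RD \<Theta> \<Theta>D (left_ann R M m)"
  shows "rational TYPE('m \<times> nat) R \<Theta> \<Theta>D M MD"
proof -
  interpret M: left_module R M by (rule graded_left_moduleD(1)[OF M])
  interpret \<Theta>: left_module R \<Theta> by (rule graded_left_moduleD(1)[OF \<Theta>])
  define H where "H = {m. homogeneous MD m}"
  have "\<exists>n N t e. m \<in> MD n \<and> (\<forall>k<N. t k \<in> \<Theta>D (e k)) \<and>
      (\<forall>r\<in>carrier R. (\<forall>k<(N::nat). r \<odot>\<^bsub>\<Theta>\<^esub> t k = \<zero>\<^bsub>\<Theta>\<^esub>) \<longrightarrow> r \<odot>\<^bsub>M\<^esub> m = \<zero>\<^bsub>M\<^esub>)" if "m \<in> H" for m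
  proof -
    have m: "homogeneous MD m" using that by (simp add: H_def)
    then obtain n where n: "m \<in> MD n" unfolding homogeneous_def by blast
    obtain S where S: "finite S" "\<forall>\<theta>\<in>S. homogeneous \<Theta>D \<theta>" "common_ann R \<Theta> S \<subseteq> left_ann R M m"
      using dist[OF m] unfolding distinguished_left_ann_iff[OF RD \<Theta> M m] by blast
    obtain N :: nat and t where t: "S = t ` {k. k < N}"
      using S(1) finite_imp_nat_seg_image_inj_on by blast
    have "\<forall>\<theta>\<in>S. \<exists>i. \<theta> \<in> \<Theta>D i" using S(2) unfolding homogeneous_def .
    then obtain e where e: "\<forall>\<theta>\<in>S. \<theta> \<in> \<Theta>D (e \<theta>)" unfolding bchoice_iff by blast
    have "r \<odot>\<^bsub>M\<^esub> m = \<zero>\<^bsub>M\<^esub>" if "r \<in> carrier R" "\<forall>k<N. r \<odot>\<^bsub>\<Theta>\<^esub> t k = \<zero>\<^bsub>\<Theta>\<^esub>" for r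
    proof -
      have "r \<in> common_ann R \<Theta> S" using that unfolding common_ann_def t by auto
      then show ?thesis using S(3) unfolding left_ann_def by blast
    qed
    then show ?thesis
      using n e t by (intro exI[of _ n] exI[of _ N] exI[of _ t] exI[of _ "\<lambda>k. e (t k)"]) auto
  qed
  then have "\<forall>m\<in>H. \<exists>n N t e. m \<in> MD n \<and> (\<forall>k<N. t k \<in> \<Theta>D (e k)) \<and>
      (\<forall>r\<in>carrier R. (\<forall>k<(N::nat). r \<odot>\<^bsub>\<Theta>\<^esub> t k = \<zero>\<^bsub>\<Theta>\<^esub>) \<longrightarrow> r \<odot>\<^bsub>M\<^esub> m = \<zero>\<^bsub>M\<^esub>)"
    by (rule ballI)
  then obtain deg N t e where
    "\<forall>m\<in>H. m \<in> MD (deg m) \<and> (\<forall>k<N m. t m k \<in> \<Theta>D (e m k)) \<and>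
      (\<forall>r\<in>carrier R. (\<forall>k<(N m::nat). r \<odot>\<^bsub>\<Theta>\<^esub> t m k = \<zero>\<^bsub>\<Theta>\<^esub>) \<longrightarrow> r \<odot>\<^bsub>M\<^esub> m = \<zero>\<^bsub>M\<^esub>)"
    unfolding bchoice_iff by blast
  then have deg: "\<And>m. m \<in> H \<Longrightarrow> m \<in> MD (deg m)"
    and tD: "\<And>m k. m \<in> H \<Longrightarrow> k < N m \<Longrightarrow> t m k \<in> \<Theta>D (e m k)"
    and ann: "\<And>m r. m \<in> H \<Longrightarrow> r \<in> carrier R \<Longrightarrow> (\<And>k. k < N m \<Longrightarrow> r \<odot>\<^bsub>\<Theta>\<^esub> t m k = \<zero>\<^bsub>\<Theta>\<^esub>) \<Longrightarrow>
      r \<odot>\<^bsub>M\<^esub> m = \<zero>\<^bsub>M\<^esub>"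
    by simp_all
  have tc: "t m k \<in> carrier \<Theta>" if "m \<in> H" "k < N m" for m k
    using grading_closed[OF graded_left_moduleD(2)[OF \<Theta>] tD[OF that]] .
  have Hc: "m \<in> carrier M" if "m \<in> H" for m
    using grading_closed[OF graded_left_moduleD(2)[OF M] deg[OF that]] .

  \<comment> \<open>The free graded module on the homogeneous elements of \<open>M\<close>, with its map onto \<open>M\<close>.\<close>
  define F where "F = coproduct_module H (\<lambda>m. self_module R)"
  define FD where "FD = coproduct_grading H (\<lambda>m. self_module R) (\<lambda>m. suspension (deg m) RD)"
  define \<phi> where "\<phi> = coproduct_map M H (\<lambda>m. self_module R) (\<lambda>m r. r \<odot>\<^bsub>M\<^esub> m)"
  have RS: "graded_left_module R RD (self_module R) (suspension i RD)" for i
    by (rule graded_left_module_suspension[OF graded_left_module_self_module[OF RD]])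
  have gF: "graded_left_module R RD F FD"
    unfolding F_def FD_def by (rule graded_left_module_coproduct[OF RD RS])
  interpret F: left_module R F by (rule graded_left_moduleD(1)[OF gF])
  have \<phi>: "\<phi> \<in> graded_hom R F FD M MD"
    unfolding \<phi>_def F_def FD_def
    by (rule graded_hom_coproduct_map[OF RD M RS]) (rule graded_hom_orbit_map[OF M deg])
  have orbit: "abelian_group_hom (self_module R) M (\<lambda>r. r \<odot>\<^bsub>M\<^esub> m)" if "m \<in> H" for m
    by (rule graded_hom_abelian_group_hom[OF graded_hom_orbit_map[OF M deg[OF that]]
        graded_left_moduleD(1)[OF graded_left_module_self_module[OF RD]] M.left_module_axioms])
  have \<phi>surj: "\<phi> ` carrier F = carrier M"
  proof
    show "\<phi> ` carrier F \<subseteq> carrier M" using \<phi> unfolding graded_hom_def by auto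
    have "graded_submodule R M MD (\<phi> ` carrier F)"
      by (rule graded_submodule_image[OF F.left_module_axioms M.left_module_axioms \<phi>
          graded_submodule_carrier[OF gF]])
    then have sub: "additive_subgroup (\<phi> ` carrier F) M"
      unfolding graded_submodule_def graded_subgroup_def by simp
    show "carrier M \<subseteq> \<phi> ` carrier F"
    proof (rule additive_subgroup_containing_homogeneous[OF M.M.abelian_group_axioms
          graded_left_moduleD(2)[OF M] sub])
      fix m assume "homogeneous MD m"
      then have m: "m \<in> H" by (simp add: H_def)
      define u where "u = (\<lambda>i\<in>H. if i = m then \<one>\<^bsub>R\<^esub> else \<zero>\<^bsub>R\<^esub>)"
      have "{i \<in> H. u i \<noteq> \<zero>\<^bsub>self_module R\<^esub>} \<subseteq> {m}" by (auto simp: u_def)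
      then have supp: "{i \<in> H. u i \<noteq> \<zero>\<^bsub>self_module R\<^esub>} \<subseteq> {m}" "finite {i \<in> H. u i \<noteq> \<zero>\<^bsub>self_module R\<^esub>}"
        by (simp_all add: finite_subset[of _ "{m}"])
      have u: "u \<in> carrier F"
        unfolding F_def coproduct_carrier using supp(2) by (simp add: u_def)
      have "\<phi> u = (\<Oplus>\<^bsub>M\<^esub>i\<in>{m}. u i \<odot>\<^bsub>M\<^esub> i)"
        unfolding \<phi>_def using u supp(1) m
        by (intro coproduct_map_superset[OF M.M.abelian_group_axioms orbit]) (auto simp: F_def)
      also have "\<dots> = m" using m Hc[OF m] by (simp add: M.M.finsum_insert u_def)
      finally show "m \<in> \<phi> ` carrier F" using u by (intro image_eqI[of _ _ u]) simp_all
    qed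
  qed

  \<comment> \<open>The basis element of \<open>m\<close> is sent to the family of the \<open>N m\<close> elements of \<open>\<Theta>\<close> whose common
    annihilator kills \<open>m\<close>; the suspensions put all of them in the degree of \<open>m\<close>. Different basis
    elements use disjoint sets of coordinates.\<close>
  define I where "I = {(m, k). m \<in> H \<and> k < N m}"
  define d where "d = (\<lambda>(m, k). deg m - e m k)"
  define C where "C = coproduct_module I (\<lambda>i. \<Theta>)"
  define CD where "CD = coproduct_grading I (\<lambda>i. \<Theta>) (\<lambda>i. suspension (d i) \<Theta>D)"
  define \<psi> where "\<psi> u = (\<lambda>i\<in>I. u (fst i) \<odot>\<^bsub>\<Theta>\<^esub> t (fst i) (snd i))" for u
  have gC: "graded_left_module R RD C CD"
    unfolding C_def CD_def
    by (rule graded_left_module_coproduct[OF RD graded_left_module_suspension[OF \<Theta>]])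
  interpret C: left_module R C by (rule graded_left_moduleD(1)[OF gC])
  have uR: "u m \<in> carrier R" if "u \<in> carrier F" "m \<in> H" for u m
    using that unfolding F_def coproduct_carrier by auto
  have IH: "fst i \<in> H" "snd i < N (fst i)" if "i \<in> I" for i
    using that by (auto simp: I_def)
  have \<psi>C: "\<psi> u \<in> carrier C" if u: "u \<in> carrier F" for u
  proof -
    have fin: "finite {m \<in> H. u m \<noteq> \<zero>\<^bsub>R\<^esub>}" using u unfolding F_def coproduct_carrier by simp
    have "{i \<in> I. \<psi> u i \<noteq> \<zero>\<^bsub>\<Theta>\<^esub>} \<subseteq> Sigma {m \<in> H. u m \<noteq> \<zero>\<^bsub>R\<^esub>} (\<lambda>m. {..<N m})"
      using tc by (auto simp: I_def \<psi>_def \<Theta>.smult_l_null)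
    moreover have "finite (Sigma {m \<in> H. u m \<noteq> \<zero>\<^bsub>R\<^esub>} (\<lambda>m. {..<N m}))"
      using fin by (intro finite_SigmaI) auto
    ultimately have "finite {i \<in> I. \<psi> u i \<noteq> \<zero>\<^bsub>\<Theta>\<^esub>}" by (rule finite_subset)
    moreover have "\<psi> u \<in> (\<Pi>\<^sub>E i\<in>I. carrier \<Theta>)"
      unfolding \<psi>_def using uR[OF u] IH tc by (intro restrict_PiE_iff[THEN iffD2] ballI \<Theta>.smult_closed) simp_all
    ultimately show ?thesis unfolding C_def coproduct_carrier by simp
  qed
  have \<psi>: "\<psi> \<in> graded_hom R F FD C CD"
  proof -
    have "\<psi> (u \<oplus>\<^bsub>F\<^esub> v) = \<psi> u \<oplus>\<^bsub>C\<^esub> \<psi> v" if "u \<in> carrier F" "v \<in> carrier F" for u v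
      using uR[OF that(1)] uR[OF that(2)] IH tc
      unfolding \<psi>_def C_def F_def coproduct_simps by (intro restrict_ext) (simp add: \<Theta>.smult_l_distr)
    moreover have "\<psi> (r \<odot>\<^bsub>F\<^esub> u) = r \<odot>\<^bsub>C\<^esub> \<psi> u" if "r \<in> carrier R" "u \<in> carrier F" for r u
      using uR[OF that(2)] IH tc that(1)
      unfolding \<psi>_def C_def F_def coproduct_simps by (intro restrict_ext) (simp add: \<Theta>.smult_assoc)
    moreover have "\<psi> u \<in> CD n" if u: "u \<in> FD n" for u n
    proof -
      have uF: "u \<in> carrier F" and ud: "\<And>m. m \<in> H \<Longrightarrow> u m \<in> RD (n - deg m)"
        using u unfolding FD_def F_def coproduct_grading_def suspension_def by auto
      have "u m \<odot>\<^bsub>\<Theta>\<^esub> t m k \<in> \<Theta>D (n - (deg m - e m k))" if "m \<in> H" "k < N m" for m k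
      proof -
        have "u m \<odot>\<^bsub>\<Theta>\<^esub> t m k \<in> \<Theta>D (n - deg m + e m k)"
          using \<Theta> ud[OF that(1)] tD[OF that] unfolding graded_left_module_def by simp
        then show ?thesis by (simp add: algebra_simps)
      qed
      then have "\<psi> u i \<in> suspension (d i) \<Theta>D n" if "i \<in> I" for i
        using that unfolding \<psi>_def d_def suspension_def by (auto simp: I_def)
      then show ?thesis
        using \<psi>C[OF uF] unfolding CD_def C_def coproduct_grading_def by simp
    qed
    ultimately show ?thesis using \<psi>C unfolding graded_hom_def by (simp add: Pi_iff image_subset_iff)
  qed
  have ker: "\<phi> u = \<zero>\<^bsub>M\<^esub>" if u: "u \<in> carrier F" and "\<psi> u = \<zero>\<^bsub>C\<^esub>" for u
  proof -
    have "u m \<odot>\<^bsub>M\<^esub> m = \<zero>\<^bsub>M\<^esub>" if m: "m \<in> H" for m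
    proof (rule ann[OF m uR[OF u m]])
      fix k assume "k < N m"
      then have "(m, k) \<in> I" using m by (simp add: I_def)
      then show "u m \<odot>\<^bsub>\<Theta>\<^esub> t m k = \<zero>\<^bsub>\<Theta>\<^esub>"
        using fun_cong[OF \<open>\<psi> u = \<zero>\<^bsub>C\<^esub>\<close>, of "(m, k)"] by (simp add: \<psi>_def C_def)
    qed
    then show ?thesis unfolding \<phi>_def coproduct_map_def by (intro M.M.add.finprod_one_eqI) simp
  qed

  \<comment> \<open>Dividing out \<open>\<psi>(ker \<phi>)\<close> leaves exactly the relations of \<open>M\<close> on the image of \<open>\<psi>\<close>.\<close>
  define L where "L = \<psi> ` {u \<in> carrier F. \<phi> u = \<zero>\<^bsub>M\<^esub>}"
  define Q where "Q = quotient_module C L"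
  define QD where "QD = quotient_grading C CD L"
  have gL: "graded_submodule R C CD L"
    unfolding L_def
    by (rule graded_submodule_image[OF F.left_module_axioms C.left_module_axioms \<psi>
        graded_submodule_kernel[OF gF M \<phi>]])
  then have sL: "submodule L R C" unfolding graded_submodule_def by simp
  note proj = quotient_projection[OF C.left_module_axioms sL, folded Q_def]
  define \<chi> where "\<chi> u = L +>\<^bsub>C\<^esub> \<psi> u" for u
  have \<chi>: "\<chi> \<in> graded_hom R F FD Q QD"
    unfolding \<chi>_def QD_def by (rule graded_hom_comp[OF \<psi> proj(2)])
  have "\<phi> u = \<zero>\<^bsub>M\<^esub> \<longleftrightarrow> \<chi> u = \<zero>\<^bsub>Q\<^esub>" if u: "u \<in> carrier F" for u
  proof -
    interpret phi: abelian_group_hom F M \<phi>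
      by (rule graded_hom_abelian_group_hom[OF \<phi> F.left_module_axioms M.left_module_axioms])
    interpret psi: abelian_group_hom F C \<psi>
      by (rule graded_hom_abelian_group_hom[OF \<psi> F.left_module_axioms C.left_module_axioms])
    have "\<chi> u = \<zero>\<^bsub>Q\<^esub> \<longleftrightarrow> \<psi> u \<in> L"
      using proj(3)[OF \<psi>C[OF u]] by (simp add: \<chi>_def Q_def quotient_module_def)
    moreover have "\<phi> u = \<zero>\<^bsub>M\<^esub>" if L: "\<psi> u \<in> L"
    proof -
      obtain v where v: "v \<in> carrier F" "\<phi> v = \<zero>\<^bsub>M\<^esub>" "\<psi> u = \<psi> v" using L unfolding L_def by auto
      have "\<psi> (u \<ominus>\<^bsub>F\<^esub> v) = \<zero>\<^bsub>C\<^esub>" using psi.eq_iff_kernel[OF u v(1)] v(3) by simp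
      then have "\<phi> (u \<ominus>\<^bsub>F\<^esub> v) = \<zero>\<^bsub>M\<^esub>"
        using ker[of "u \<ominus>\<^bsub>F\<^esub> v"] u v(1) by (simp add: a_minus_def)
      then show ?thesis using phi.eq_iff_kernel[OF u v(1)] v(2) by simp
    qed
    moreover have "\<psi> u \<in> L" if "\<phi> u = \<zero>\<^bsub>M\<^esub>" unfolding L_def using u that by simp
    ultimately show ?thesis by metis
  qed
  from graded_iso_of_equal_kernels[OF gF M proj(1) \<phi> \<phi>surj \<chi> this]
  have iso: "graded_iso R M MD (Q\<lparr>carrier := \<chi> ` carrier F\<rparr>) (\<lambda>n. QD n \<inter> \<chi> ` carrier F) \<noteq> {}" .
  have gK: "graded_submodule R Q QD (\<chi> ` carrier F)"
    by (rule graded_submodule_image[OF F.left_module_axioms proj(1) \<chi> graded_submodule_carrier[OF gF]])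
  show ?thesis
    unfolding rational_def Let_def
    by (intro exI[of _ I] exI[of _ d] exI[of _ L] exI[of _ "\<chi> ` carrier F"] conjI)
      (use gL gK iso in \<open>simp_all add: C_def CD_def Q_def QD_def\<close>)
qed


section \<open>Torsion\<close>

definition torsion_elements ::
    "('a, 'c) ring_scheme \<Rightarrow> (int \<Rightarrow> 'a set) \<Rightarrow> ('a, 't, 'e) module_scheme \<Rightarrow> (int \<Rightarrow> 't set) \<Rightarrow>
     ('a, 'm, 'd) module_scheme \<Rightarrow> (int \<Rightarrow> 'm set) \<Rightarrow> 'm set" where
  "torsion_elements R RD \<Theta> \<Theta>D M MD =
     {m. homogeneous MD m \<and> (\<exists>I\<in>dist_bar R RD \<Theta> \<Theta>D. \<forall>r\<in>I. r \<odot>\<^bsub>M\<^esub> m = \<zero>\<^bsub>M\<^esub>)}"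

lemma torsion_elements_iff:
  assumes RD: "graded_ring R RD" and \<Theta>: "graded_left_module R RD \<Theta> \<Theta>D"
  shows "m \<in> torsion_elements R RD \<Theta> \<Theta>D M MD \<longleftrightarrow> homogeneous MD m \<and>
    (\<exists>S. finite S \<and> (\<forall>\<theta>\<in>S. homogeneous \<Theta>D \<theta>) \<and> (\<forall>r\<in>common_ann R \<Theta> S. r \<odot>\<^bsub>M\<^esub> m = \<zero>\<^bsub>M\<^esub>))"
  unfolding torsion_elements_def mem_Collect_eq Bex_def dist_bar_iff[OF RD \<Theta>] by metis

lemma torsion_elements_iff_distinguished:
  assumes RD: "graded_ring R RD" and \<Theta>: "graded_left_module R RD \<Theta> \<Theta>D"
    and M: "graded_left_module R RD M MD" and m: "homogeneous MD m"
  shows "m \<in> torsion_elements R RD \<Theta> \<Theta>D M MD \<longleftrightarrow> distinguished R RD \<Theta> \<Theta>D (left_ann R M m)"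
proof -
  have "common_ann R \<Theta> S \<subseteq> left_ann R M m \<longleftrightarrow> (\<forall>r\<in>common_ann R \<Theta> S. r \<odot>\<^bsub>M\<^esub> m = \<zero>\<^bsub>M\<^esub>)" for S
    by (auto simp: left_ann_def common_ann_def)
  then show ?thesis
    unfolding torsion_elements_iff[OF RD \<Theta>] distinguished_left_ann_iff[OF RD \<Theta> M m] using m by simp
qed

lemma homogeneous_smult:
  assumes "graded_left_module R RD M MD" "a \<in> RD i" "homogeneous MD x"
  shows "homogeneous MD (a \<odot>\<^bsub>M\<^esub> x)"
proof -
  obtain j where "x \<in> MD j" using assms(3) unfolding homogeneous_def by auto
  then have "a \<odot>\<^bsub>M\<^esub> x \<in> MD (i + j)" using assms(1,2) unfolding graded_left_module_def by simp
  then show ?thesis unfolding homogeneous_def by (rule exI)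
qed

text \<open>
  If \<open>m\<close> is killed by the common annihilator of a finite set \<open>S\<close> and \<open>a\<close> is homogeneous, then
  \<open>a m\<close> is killed by the common annihilator of \<open>a S\<close>.
\<close>

lemma torsion_elements_smult:
  assumes RD: "graded_ring R RD" and \<Theta>: "graded_left_module R RD \<Theta> \<Theta>D"
    and M: "graded_left_module R RD M MD"
    and a: "a \<in> RD i" and m: "m \<in> torsion_elements R RD \<Theta> \<Theta>D M MD"
  shows "a \<odot>\<^bsub>M\<^esub> m \<in> torsion_elements R RD \<Theta> \<Theta>D M MD"
proof -
  interpret M: left_module R M by (rule graded_left_moduleD(1)[OF M])
  interpret \<Theta>: left_module R \<Theta> by (rule graded_left_moduleD(1)[OF \<Theta>])
  have "grading R RD" using RD unfolding graded_ring_def by simp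
  then have aR: "a \<in> carrier R" using a by (rule grading_closed)
  obtain S where S: "finite S" "\<forall>\<theta>\<in>S. homogeneous \<Theta>D \<theta>" "\<forall>r\<in>common_ann R \<Theta> S. r \<odot>\<^bsub>M\<^esub> m = \<zero>\<^bsub>M\<^esub>"
    and mh: "homogeneous MD m"
    using m unfolding torsion_elements_iff[OF RD \<Theta>] by auto
  obtain n where n: "m \<in> MD n" using mh unfolding homogeneous_def by auto
  have mc: "m \<in> carrier M" by (rule grading_closed[OF graded_left_moduleD(2)[OF M] n])
  have Sc: "\<theta> \<in> carrier \<Theta>" if "\<theta> \<in> S" for \<theta>
    using S(2) that grading_closed[OF graded_left_moduleD(2)[OF \<Theta>]] unfolding homogeneous_def by auto
  let ?S = "(\<lambda>\<theta>. a \<odot>\<^bsub>\<Theta>\<^esub> \<theta>) ` S"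
  have "finite ?S" using S(1) by simp
  moreover have "\<forall>\<theta>\<in>?S. homogeneous \<Theta>D \<theta>" using S(2) homogeneous_smult[OF \<Theta> a] by auto
  moreover have "\<forall>r\<in>common_ann R \<Theta> ?S. r \<odot>\<^bsub>M\<^esub> (a \<odot>\<^bsub>M\<^esub> m) = \<zero>\<^bsub>M\<^esub>"
  proof
    fix r assume "r \<in> common_ann R \<Theta> ?S"
    then have r: "r \<in> carrier R" and "\<And>\<theta>. \<theta> \<in> S \<Longrightarrow> r \<odot>\<^bsub>\<Theta>\<^esub> (a \<odot>\<^bsub>\<Theta>\<^esub> \<theta>) = \<zero>\<^bsub>\<Theta>\<^esub>"
      unfolding common_ann_def by auto
    then have "r \<otimes>\<^bsub>R\<^esub> a \<in> common_ann R \<Theta> S"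
      unfolding common_ann_def using Sc aR by (simp add: \<Theta>.smult_assoc)
    then have "(r \<otimes>\<^bsub>R\<^esub> a) \<odot>\<^bsub>M\<^esub> m = \<zero>\<^bsub>M\<^esub>" using S(3) by simp
    then show "r \<odot>\<^bsub>M\<^esub> (a \<odot>\<^bsub>M\<^esub> m) = \<zero>\<^bsub>M\<^esub>" using M.smult_assoc[OF r aR mc] by simp
  qed
  ultimately show ?thesis
    unfolding torsion_elements_iff[OF RD \<Theta>] using homogeneous_smult[OF M a mh] by (intro conjI exI[of _ ?S])
qed

lemma torsion_elements_add:
  assumes RD: "graded_ring R RD" and \<Theta>: "graded_left_module R RD \<Theta> \<Theta>D"
    and M: "graded_left_module R RD M MD"
    and x: "x \<in> torsion_elements R RD \<Theta> \<Theta>D M MD" "x \<in> MD n"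
    and y: "y \<in> torsion_elements R RD \<Theta> \<Theta>D M MD" "y \<in> MD n"
  shows "x \<oplus>\<^bsub>M\<^esub> y \<in> torsion_elements R RD \<Theta> \<Theta>D M MD"
proof -
  interpret M: left_module R M by (rule graded_left_moduleD(1)[OF M])
  note gr = graded_left_moduleD(2)[OF M]
  have c: "x \<in> carrier M" "y \<in> carrier M" using grading_closed[OF gr] x(2) y(2) by simp_all
  obtain S where S: "finite S" "\<forall>\<theta>\<in>S. homogeneous \<Theta>D \<theta>" "\<forall>r\<in>common_ann R \<Theta> S. r \<odot>\<^bsub>M\<^esub> x = \<zero>\<^bsub>M\<^esub>"
    using x(1) unfolding torsion_elements_iff[OF RD \<Theta>] by auto
  obtain S' where S': "finite S'" "\<forall>\<theta>\<in>S'. homogeneous \<Theta>D \<theta>" "\<forall>r\<in>common_ann R \<Theta> S'. r \<odot>\<^bsub>M\<^esub> y = \<zero>\<^bsub>M\<^esub>"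
    using y(1) unfolding torsion_elements_iff[OF RD \<Theta>] by auto
  have "additive_subgroup (MD n) M" using gr unfolding grading_def by simp
  then have "x \<oplus>\<^bsub>M\<^esub> y \<in> MD n" using x(2) y(2) by (rule additive_subgroup.a_closed)
  then have "homogeneous MD (x \<oplus>\<^bsub>M\<^esub> y)" unfolding homogeneous_def by (rule exI)
  moreover have "finite (S \<union> S')" using S(1) S'(1) by simp
  moreover have "\<forall>\<theta>\<in>S \<union> S'. homogeneous \<Theta>D \<theta>" using S(2) S'(2) by auto
  moreover have "\<forall>r\<in>common_ann R \<Theta> (S \<union> S'). r \<odot>\<^bsub>M\<^esub> (x \<oplus>\<^bsub>M\<^esub> y) = \<zero>\<^bsub>M\<^esub>"
  proof
    fix r assume r: "r \<in> common_ann R \<Theta> (S \<union> S')"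
    then have "r \<in> carrier R" "r \<in> common_ann R \<Theta> S" "r \<in> common_ann R \<Theta> S'"
      unfolding common_ann_def by auto
    then show "r \<odot>\<^bsub>M\<^esub> (x \<oplus>\<^bsub>M\<^esub> y) = \<zero>\<^bsub>M\<^esub>"
      using S(3) S'(3) c by (simp add: M.smult_r_distr)
  qed
  ultimately show ?thesis
    unfolding torsion_elements_iff[OF RD \<Theta>] by (intro conjI exI[of _ "S \<union> S'"])
qed

lemma torsion_elements_zero:
  assumes RD: "graded_ring R RD" and \<Theta>: "graded_left_module R RD \<Theta> \<Theta>D"
    and M: "graded_left_module R RD M MD"
  shows "\<zero>\<^bsub>M\<^esub> \<in> torsion_elements R RD \<Theta> \<Theta>D M MD"
  unfolding torsion_elements_iff[OF RD \<Theta>]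
  using grading_zero[OF graded_left_moduleD(2)[OF M]]
    left_module.smult_r_null[OF graded_left_moduleD(1)[OF M]]
  by (intro conjI exI[of _ "{}"]) (auto simp: homogeneous_def common_ann_def)

text \<open>
  This is an explicit form of the submodule \<open>H0_dist\<close>. Membership is tested on components because
  torsion elements are homogeneous by definition, and components are unique; so the homogeneous
  elements of this submodule are again torsion.
\<close>

definition torsion_part ::
    "('a, 'c) ring_scheme \<Rightarrow> (int \<Rightarrow> 'a set) \<Rightarrow> ('a, 't, 'e) module_scheme \<Rightarrow> (int \<Rightarrow> 't set) \<Rightarrow>
     ('a, 'm, 'd) module_scheme \<Rightarrow> (int \<Rightarrow> 'm set) \<Rightarrow> 'm set" where
  "torsion_part R RD \<Theta> \<Theta>D M MD = {x \<in> carrier M.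
     \<exists>f. homogeneous_decomposition M MD x f \<and> range f \<subseteq> torsion_elements R RD \<Theta> \<Theta>D M MD}"

lemma torsion_elements_subset_torsion_part:
  assumes RD: "graded_ring R RD" and \<Theta>: "graded_left_module R RD \<Theta> \<Theta>D"
    and M: "graded_left_module R RD M MD"
  shows "torsion_elements R RD \<Theta> \<Theta>D M MD \<subseteq> torsion_part R RD \<Theta> \<Theta>D M MD"
proof
  fix x assume x: "x \<in> torsion_elements R RD \<Theta> \<Theta>D M MD"
  then obtain n where n: "x \<in> MD n" unfolding torsion_elements_def homogeneous_def by auto
  have "range (\<lambda>k. if k = n then x else \<zero>\<^bsub>M\<^esub>) \<subseteq> torsion_elements R RD \<Theta> \<Theta>D M MD"
    using x torsion_elements_zero[OF RD \<Theta> M] by auto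
  with homogeneous_decomposition_single[OF graded_left_moduleD(3,2)[OF M] n]
    grading_closed[OF graded_left_moduleD(2)[OF M] n]
  show "x \<in> torsion_part R RD \<Theta> \<Theta>D M MD"
    unfolding torsion_part_def
    by (intro CollectI conjI exI[of _ "\<lambda>k. if k = n then x else \<zero>\<^bsub>M\<^esub>"])
qed

text \<open>
  Multiplication by an arbitrary \<open>a\<close> reduces, by expanding both \<open>a\<close> and \<open>x\<close> into components, to
  products of a homogeneous scalar and a torsion element.
\<close>

lemma graded_submodule_torsion_part:
  assumes RD: "graded_ring R RD" and \<Theta>: "graded_left_module R RD \<Theta> \<Theta>D"
    and M: "graded_left_module R RD M MD"
  shows "graded_submodule R M MD (torsion_part R RD \<Theta> \<Theta>D M MD)"
proof -
  interpret M: left_module R M by (rule graded_left_moduleD(1)[OF M])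
  note gr = graded_left_moduleD(2)[OF M] and ab = graded_left_moduleD(3)[OF M]
  define T where "T = torsion_elements R RD \<Theta> \<Theta>D M MD"
  let ?N = "{x \<in> carrier M. \<exists>f. homogeneous_decomposition M MD x f \<and> range f \<subseteq> T}"
  have N: "torsion_part R RD \<Theta> \<Theta>D M MD = ?N" unfolding torsion_part_def T_def ..
  have grR: "grading R RD" using RD unfolding graded_ring_def by simp
  have T0: "\<zero>\<^bsub>M\<^esub> \<in> T"
    unfolding T_def by (rule torsion_elements_zero[OF RD \<Theta> M])
  have T1: "x \<in> ?N" if x: "x \<in> T" for x
    using torsion_elements_subset_torsion_part[OF RD \<Theta> M] x unfolding N T_def[symmetric] by (rule subsetD)
  have add: "x \<oplus>\<^bsub>M\<^esub> y \<in> ?N" if x: "x \<in> ?N" and y: "y \<in> ?N" for x y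
  proof -
    obtain f where f: "homogeneous_decomposition M MD x f" "range f \<subseteq> T" using x by auto
    obtain g where g: "homogeneous_decomposition M MD y g" "range g \<subseteq> T" using y by auto
    have fg: "f n \<in> MD n" "g n \<in> MD n" for n
      using f(1) g(1) unfolding homogeneous_decomposition_def by auto
    have fgc: "f \<in> UNIV \<rightarrow> carrier M" "g \<in> UNIV \<rightarrow> carrier M"
      using homogeneous_decomposition_carrier[OF gr] f(1) g(1) by simp_all
    have fgT: "f n \<oplus>\<^bsub>M\<^esub> g n \<in> T" for n
    proof -
      have "f n \<in> T" "g n \<in> T" using f(2) g(2) by auto
      then show ?thesis unfolding T_def using torsion_elements_add[OF RD \<Theta> M _ fg(1) _ fg(2)] by simp
    qed
    let ?A = "{n. f n \<noteq> \<zero>\<^bsub>M\<^esub>} \<union> {n. g n \<noteq> \<zero>\<^bsub>M\<^esub>}"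
    have A: "finite ?A" using f(1) g(1) unfolding homogeneous_decomposition_def by simp
    have "x = finsum M f ?A"
      using homogeneous_decomposition_superset[OF ab fgc(1) A, of MD x] f(1) by auto
    moreover have "y = finsum M g ?A"
      using homogeneous_decomposition_superset[OF ab fgc(2) A, of MD y] g(1) by auto
    moreover have fgA: "f \<in> ?A \<rightarrow> carrier M" "g \<in> ?A \<rightarrow> carrier M" using fgc by auto
    ultimately have sum: "x \<oplus>\<^bsub>M\<^esub> y = (\<Oplus>\<^bsub>M\<^esub>n\<in>?A. f n \<oplus>\<^bsub>M\<^esub> g n)"
      using M.M.finsum_addf[OF fgA] by simp
    have "f n \<oplus>\<^bsub>M\<^esub> g n \<in> MD n" for n
    proof -
      have "additive_subgroup (MD n) M" using gr unfolding grading_def by simp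
      then show ?thesis using fg by (rule additive_subgroup.a_closed)
    qed
    moreover have "(\<lambda>n. f n \<oplus>\<^bsub>M\<^esub> g n) \<in> UNIV \<rightarrow> carrier M" using fgc by auto
    moreover have "{n. f n \<oplus>\<^bsub>M\<^esub> g n \<noteq> \<zero>\<^bsub>M\<^esub>} \<subseteq> ?A" by auto
    ultimately have "homogeneous_decomposition M MD (x \<oplus>\<^bsub>M\<^esub> y) (\<lambda>n. f n \<oplus>\<^bsub>M\<^esub> g n)"
      using homogeneous_decomposition_superset[OF ab _ A, of "\<lambda>n. f n \<oplus>\<^bsub>M\<^esub> g n" MD "x \<oplus>\<^bsub>M\<^esub> y"] sum by simp
    moreover have "range (\<lambda>n. f n \<oplus>\<^bsub>M\<^esub> g n) \<subseteq> T" using fgT by auto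
    moreover have "x \<oplus>\<^bsub>M\<^esub> y \<in> carrier M" using x y by simp
    ultimately show ?thesis by (intro CollectI conjI exI[of _ "\<lambda>n. f n \<oplus>\<^bsub>M\<^esub> g n"])
  qed
  have Nc: "?N \<subseteq> carrier M" by auto
  note sum = M.M.finsum_in_subset[OF Nc T1[OF T0] add]
  have smT: "a \<odot>\<^bsub>M\<^esub> x \<in> ?N" if a: "a \<in> carrier R" and x: "x \<in> T" for a x
  proof -
    have xc: "x \<in> carrier M" using T1[OF x] by simp
    obtain f where f: "homogeneous_decomposition R RD a f" "f \<in> UNIV \<rightarrow> carrier R"
      using homogeneous_decomposition_exists[OF grR a] .
    let ?A = "{n. f n \<noteq> \<zero>\<^bsub>R\<^esub>}"
    have af: "a = finsum R f ?A" and fD: "\<And>n. f n \<in> RD n"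
      using f(1) unfolding homogeneous_decomposition_def by simp_all
    have fA: "f \<in> ?A \<rightarrow> carrier R" using f(2) by auto
    have "a \<odot>\<^bsub>M\<^esub> x = (\<Oplus>\<^bsub>M\<^esub>n\<in>?A. f n \<odot>\<^bsub>M\<^esub> x)"
      using abelian_group_hom.hom_finsum[OF M.smult_l_hom[OF xc] fA] af by simp
    also have "\<dots> \<in> ?N"
    proof (rule sum)
      fix n assume "n \<in> ?A"
      show "f n \<odot>\<^bsub>M\<^esub> x \<in> ?N"
        using T1 torsion_elements_smult[OF RD \<Theta> M fD[of n]] x unfolding T_def by simp
    qed
    finally show ?thesis .
  qed
  have "submodule ?N R M"
  proof (rule M.submoduleI[OF Nc T1[OF T0] add])
    fix a x assume a: "a \<in> carrier R" and x: "x \<in> ?N"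
    obtain f where f: "homogeneous_decomposition M MD x f" "range f \<subseteq> T" using x by auto
    let ?A = "{n. f n \<noteq> \<zero>\<^bsub>M\<^esub>}"
    have xf: "x = finsum M f ?A" using f(1) unfolding homogeneous_decomposition_def by simp
    have fA: "f \<in> ?A \<rightarrow> carrier M" using homogeneous_decomposition_carrier[OF gr f(1)] by auto
    have "a \<odot>\<^bsub>M\<^esub> x = (\<Oplus>\<^bsub>M\<^esub>n\<in>?A. a \<odot>\<^bsub>M\<^esub> f n)"
      using abelian_group_hom.hom_finsum[OF M.smult_r_hom[OF a] fA] xf by simp
    also have "\<dots> \<in> ?N"
    proof (rule sum)
      fix n assume "n \<in> ?A"
      show "a \<odot>\<^bsub>M\<^esub> f n \<in> ?N" using smT[OF a] f(2) by auto
    qed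
    finally show "a \<odot>\<^bsub>M\<^esub> x \<in> ?N" .
  qed
  moreover have "\<forall>x\<in>?N. \<exists>f. homogeneous_decomposition M MD x f \<and> range f \<subseteq> ?N"
  proof
    fix x assume x: "x \<in> ?N"
    obtain f where f: "homogeneous_decomposition M MD x f" "range f \<subseteq> T" using x by auto
    have "range f \<subseteq> ?N" by (rule subset_trans[OF f(2) subsetI[OF T1]])
    with f(1) show "\<exists>f. homogeneous_decomposition M MD x f \<and> range f \<subseteq> ?N" by (intro exI[of _ f] conjI)
  qed
  ultimately show ?thesis
    unfolding N graded_submodule_def graded_subgroup_def by (intro conjI submodule_additive_subgroup)
qed

lemma distinguished_torsion_iff:
  assumes M: "graded_left_module R RD M MD"
  shows "distinguished_torsion R RD \<Theta> \<Theta>D M MD \<longleftrightarrow> H0_dist R RD \<Theta> \<Theta>D M MD = carrier M"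
proof
  assume "distinguished_torsion R RD \<Theta> \<Theta>D M MD"
  then have "bij_betw (\<lambda>m. m) (H0_dist R RD \<Theta> \<Theta>D M MD) (carrier M)"
    unfolding distinguished_torsion_def Let_def graded_iso_def by simp
  then show "H0_dist R RD \<Theta> \<Theta>D M MD = carrier M" by (simp add: bij_betw_def)
next
  assume "H0_dist R RD \<Theta> \<Theta>D M MD = carrier M"
  then show "distinguished_torsion R RD \<Theta> \<Theta>D M MD"
    unfolding distinguished_torsion_def Let_def graded_iso_def by (simp add: bij_betw_def)
qed

lemma distinguished_iff_torsion:
  assumes RD: "graded_ring R RD" and \<Theta>: "graded_left_module R RD \<Theta> \<Theta>D"
    and M: "graded_left_module R RD M MD"
  shows "(\<forall>m. homogeneous MD m \<longrightarrow> distinguished R RD \<Theta> \<Theta>D (left_ann R M m)) \<longleftrightarrow>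
    distinguished_torsion R RD \<Theta> \<Theta>D M MD"
proof -
  let ?T = "torsion_elements R RD \<Theta> \<Theta>D M MD"
  note gr = graded_left_moduleD(2)[OF M] and ab = graded_left_moduleD(3)[OF M]
  have h0: "h0_dist R RD \<Theta> \<Theta>D M MD = graded_subgroup M MD hull ?T"
    unfolding h0_dist_def torsion_elements_def by simp
  have "(\<forall>m. homogeneous MD m \<longrightarrow> m \<in> ?T) \<longleftrightarrow> H0_dist R RD \<Theta> \<Theta>D M MD = carrier M"
  proof
    assume hom: "\<forall>m. homogeneous MD m \<longrightarrow> m \<in> ?T"
    have "carrier M \<subseteq> H" if H: "graded_submodule R M MD H" "h0_dist R RD \<Theta> \<Theta>D M MD \<subseteq> H" for H
    proof (rule additive_subgroup_containing_homogeneous[OF ab gr])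
      show "additive_subgroup H M" using H(1) unfolding graded_submodule_def graded_subgroup_def by simp
      have "?T \<subseteq> H" using hull_subset[of ?T "graded_subgroup M MD"] H(2) unfolding h0 by (rule subset_trans)
      then show "m \<in> H" if "homogeneous MD m" for m using hom that by auto
    qed
    moreover have "graded_submodule R M MD (carrier M)" by (rule graded_submodule_carrier[OF M])
    moreover have "h0_dist R RD \<Theta> \<Theta>D M MD \<subseteq> carrier M"
    proof -
      have "?T \<subseteq> carrier M"
        using grading_closed[OF gr] unfolding torsion_elements_def homogeneous_def by auto
      moreover have "graded_subgroup M MD (carrier M)"
        using graded_submodule_carrier[OF M] unfolding graded_submodule_def by simp
      ultimately show ?thesis unfolding h0 by (rule hull_minimal)
    qed
    ultimately show "H0_dist R RD \<Theta> \<Theta>D M MD = carrier M"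
      unfolding H0_dist_def by (intro hull_unique) simp_all
  next
    assume H0: "H0_dist R RD \<Theta> \<Theta>D M MD = carrier M"
    let ?N = "torsion_part R RD \<Theta> \<Theta>D M MD"
    have N: "graded_submodule R M MD ?N" by (rule graded_submodule_torsion_part[OF RD \<Theta> M])
    then have "graded_subgroup M MD ?N" unfolding graded_submodule_def by (rule conjunct2)
    with torsion_elements_subset_torsion_part[OF RD \<Theta> M]
    have "h0_dist R RD \<Theta> \<Theta>D M MD \<subseteq> ?N" unfolding h0 by (rule hull_minimal)
    then have "H0_dist R RD \<Theta> \<Theta>D M MD \<subseteq> ?N" unfolding H0_dist_def using N by (rule hull_minimal)
    then have all: "carrier M \<subseteq> ?N" unfolding H0 .
    show "\<forall>m. homogeneous MD m \<longrightarrow> m \<in> ?T"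
    proof (intro allI impI)
      fix m assume "homogeneous MD m"
      then obtain n where n: "m \<in> MD n" unfolding homogeneous_def by auto
      have mc: "m \<in> carrier M" by (rule grading_closed[OF gr n])
      have "m \<in> ?N" by (rule subsetD[OF all mc])
      then obtain f where f: "homogeneous_decomposition M MD m f" "range f \<subseteq> ?T"
        unfolding torsion_part_def by auto
      from homogeneous_decomposition_unique[OF gr mc f(1) homogeneous_decomposition_single[OF ab gr n]]
      have "f n = m" by simp
      then show "m \<in> ?T" using f(2) by auto
    qed
  qed
  then show ?thesis
    unfolding distinguished_torsion_iff[OF M] using torsion_elements_iff_distinguished[OF RD \<Theta> M] by simp
qed


section \<open>Rational, distinguished and torsion modules coincide\<close>

theorem theorem3p7:
  fixes R :: "('a, 'c) ring_scheme" and RD :: "int \<Rightarrow> 'a set"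
    and \<Theta> :: "('a, 't, 'e) module_scheme" and \<Theta>D :: "int \<Rightarrow> 't set"
    and M :: "('a, 'm, 'd) module_scheme" and MD :: "int \<Rightarrow> 'm set"
  assumes "graded_ring R RD"
    and "graded_left_module R RD \<Theta> \<Theta>D"
    and "graded_left_module R RD M MD"
  shows "(rational TYPE('i) R \<Theta> \<Theta>D M MD \<longrightarrow> rational TYPE('m \<times> nat) R \<Theta> \<Theta>D M MD) \<and>
    (rational TYPE('m \<times> nat) R \<Theta> \<Theta>D M MD \<longleftrightarrow>
       (\<forall>m. homogeneous MD m \<longrightarrow> distinguished R RD \<Theta> \<Theta>D (left_ann R M m))) \<and>
    ((\<forall>m. homogeneous MD m \<longrightarrow> distinguished R RD \<Theta> \<Theta>D (left_ann R M m)) \<longleftrightarrow>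
       distinguished_torsion R RD \<Theta> \<Theta>D M MD)"
  using rational_imp_distinguished[OF assms] distinguished_imp_rational[OF assms]
    distinguished_iff_torsion[OF assms] by metis

end
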